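(* For every $n \ge 3$, there exist $u\in\mathbb{S}^{n-1}$, an $(n-1)$-dimensional convex body $C\subset u^\perp\subset \mathbb{R}^n$, and a convex body $A\in\mathcal{K}_C$, such that $$\frac{\mathcal{H}^n(A)}{\mathcal{H}^{n-1}(\partial A)}>\lim_{h\rightarrow \infty}\frac{\mathcal{H}^n(C_h)}{\mathcal{H}^{n-1}(\partial C_h)},$$ where $C_h=C+h[\underline{0},u]$ is the orthogonal cylinder over $C$ with height $h$.
   Context: A convex body is a nonempty compact convex subset of $\mathbb{R}^n$; its dimension is that of its affine hull. $\mathcal{H}^k$ is the $k$-dimensional Hausdorff measure. $\mathbb{S}^{n-1}$ is the Euclidean unit sphere, $u^\perp$ is the hyperplane through the origin $\underline{0}$ orthogonal to $u$, $P_{u^\perp}$ is the orthogonal projection onto $u^\perp$, and $[\underline{0},u]$ is the segment from $\underline{0}$ to $u$. $\partial$ denotes boundary. For an $(n-1)$-dimensional convex body $C\subset u^\perp$, the canal class of $C$ (with respect to $u$) is $\mathcal{K}_C=\{K\subset\mathbb{R}^n \text{ convex body with nonempty interior}:\ P_{u^\perp}(K)=C\}$. *)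

theory Defs
  imports "HOL-Analysis.Analysis"
begin

definition convex_body :: "'a::euclidean_space set \<Rightarrow> bool" where
  "convex_body K \<longleftrightarrow> K \<noteq> {} \<and> compact K \<and> convex K"

text \<open>
  The \<open>k\<close>-dimensional Hausdorff measure, as an outer measure on all subsets, with the usual
  normalisation by the volume of the unit ball of \<open>\<real>\<^sup>k\<close>, under which \<open>\<H>\<^sup>n\<close> on \<open>\<real>\<^sup>n\<close> is Lebesgue
  measure.  The empty set contributes 0 to a cover also when \<open>k = 0\<close> (where \<open>0 ^ 0 = 1\<close>), and
  covering sets must be required to be bounded because \<open>diameter\<close> is unspecified on unbounded
  sets.
\<close>

definition hausdorff_gauge :: "nat \<Rightarrow> 'a::metric_space set \<Rightarrow> ennreal" where
  "hausdorff_gauge k U =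
     (if U = {} then 0 else ennreal (unit_ball_vol (real k) * (diameter U / 2) ^ k))"

definition hausdorff_pre :: "nat \<Rightarrow> real \<Rightarrow> 'a::metric_space set \<Rightarrow> ennreal" where
  "hausdorff_pre k \<delta> E =
     (INF U \<in> {U :: nat \<Rightarrow> 'a set. E \<subseteq> (\<Union>i. U i) \<and> (\<forall>i. bounded (U i) \<and> diameter (U i) \<le> \<delta>)}.
        \<Sum>i. hausdorff_gauge k (U i))"

definition hausdorff :: "nat \<Rightarrow> 'a::metric_space set \<Rightarrow> ennreal" where
  "hausdorff k E = (SUP \<delta> \<in> {0<..}. hausdorff_pre k \<delta> E)"

definition orth_hyperplane :: "'a::euclidean_space \<Rightarrow> 'a set" where
  "orth_hyperplane u = {x. u \<bullet> x = 0}"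

text \<open>The orthogonal projection onto \<open>orth_hyperplane u\<close>, for a unit vector \<open>u\<close>.\<close>

definition orth_proj :: "'a::euclidean_space \<Rightarrow> 'a \<Rightarrow> 'a" where
  "orth_proj u x = x - (x \<bullet> u) *\<^sub>R u"

lemma orth_proj_eq_closest_point:
  assumes "norm u = 1"
  shows "orth_proj u x = closest_point (orth_hyperplane u) x"
proof (rule closest_point_unique)
  show "convex (orth_hyperplane u)" "closed (orth_hyperplane u)"
    unfolding orth_hyperplane_def by (rule convex_hyperplane closed_hyperplane)+
  have uu: "u \<bullet> u = 1"
    using assms by (simp add: norm_eq_1)
  show "orth_proj u x \<in> orth_hyperplane u"
    by (simp add: orth_proj_def orth_hyperplane_def inner_diff_right inner_commute uu)
  show "\<forall>z\<in>orth_hyperplane u. dist x (orth_proj u x) \<le> dist x z"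
  proof
    fix z assume "z \<in> orth_hyperplane u"
    then have "\<bar>x \<bullet> u\<bar> = \<bar>(x - z) \<bullet> u\<bar>"
      by (simp add: orth_hyperplane_def inner_diff_left inner_diff_right inner_commute)
    also have "\<dots> \<le> norm (x - z) * norm u"
      by (rule Cauchy_Schwarz_ineq2)
    finally show "dist x (orth_proj u x) \<le> dist x z"
      using assms by (simp add: orth_proj_def dist_norm)
  qed
qed

definition canal_class :: "'a::euclidean_space \<Rightarrow> 'a set \<Rightarrow> 'a set set" where
  "canal_class u C = {K. convex_body K \<and> interior K \<noteq> {} \<and> orth_proj u ` K = C}"

text \<open>Here \<open>+\<close> on sets is the Minkowski sum.\<close>

definition cylinder :: "'a::euclidean_space \<Rightarrow> 'a set \<Rightarrow> real \<Rightarrow> 'a set" where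
  "cylinder u C h = C + (\<lambda>x. h *\<^sub>R x) ` closed_segment 0 u"

end

theory Submission
  imports Defs
begin

text \<open>
  Let \<open>C\<close> be the unit cube of dimension \<open>n - 1\<close>.  The quotient of volume and surface area of \<open>C\<close>
  increases when an edge of codimension 2 is chamfered at a small scale \<open>a\<close>: the gain in surface
  area is linear in \<open>a\<close>, the loss of volume quadratic.  So we take the cylinder of large height
  \<open>h\<close> over \<open>C\<close> and cut it along a steep hyperplane that meets the bottom only in such an edge
  (so that the projection is still \<open>C\<close>) and has cut off legs of length \<open>a\<close> at the top.  For fixed
  \<open>a\<close> the gain is proportional to \<open>h\<close> and so beats the constant area of top and bottom.

  Only the Hausdorff measures of boxes are needed exactly, and these only up to a common factor
  for each dimension, which cancels in the comparison; so the isodiametric inequality is not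
  needed.  On boxes, additivity up to gaps of arbitrarily small width (Hausdorff measure adds on
  separated sets) forces the measure to be linear in each side length.
\<close>

section \<open>Hausdorff measure as a metric outer measure\<close>

text \<open>Each of the two lateral facets at the cut edge loses a right triangle with legs a and h
  (times a unit cube), together an area of a h, while the slanted facet adds about a h / sqrt 2. So
  about 0.29 a h of area is saved, against a volume loss of order a^2 h and the constant 2 for
  bottom and top: a has to be small compared with 1 / n, and then a h large. The edge needs two
  directions orthogonal to the axis, which is where n >= 3 enters. The estimates for the cut body
  are one-sided: its boundary is bounded above by covering it with facets, its volume below by
  subadditivity. A lower bound on a boundary is required only for the cylinders, and there only for
  the lateral facets. Since everything is phrased for the outer measure, maps that do not decrease
  distances take the place of isometries, which turns irrational lengths into rational upper
  bounds.\<close>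

lemma hausdorff_pre_le:
  assumes "E \<subseteq> (\<Union>i. U i)" "\<And>i. bounded (U i)" "\<And>i. diameter (U i) \<le> \<delta>"
  shows "hausdorff_pre k \<delta> E \<le> (\<Sum>i. hausdorff_gauge k (U i))"
  unfolding hausdorff_pre_def using assms by (intro INF_lower) auto

lemma hausdorff_pre_greatest:
  assumes "\<And>U. \<lbrakk>E \<subseteq> (\<Union>i. U i); \<And>i. bounded (U i); \<And>i. diameter (U i) \<le> \<delta>\<rbrakk>
            \<Longrightarrow> X \<le> (\<Sum>i. hausdorff_gauge k (U i))"
  shows "X \<le> hausdorff_pre k \<delta> E"
  unfolding hausdorff_pre_def using assms by (intro INF_greatest) auto

lemma hausdorff_pre_antimono:
  assumes "\<delta>' \<le> \<delta>"
  shows "hausdorff_pre k \<delta> E \<le> hausdorff_pre k \<delta>' E"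
  by (rule hausdorff_pre_greatest, rule hausdorff_pre_le) (use assms order_trans in blast)+

lemma hausdorff_pre_le_hausdorff: "0 < \<delta> \<Longrightarrow> hausdorff_pre k \<delta> E \<le> hausdorff k E"
  unfolding hausdorff_def by (intro SUP_upper) auto

lemma hausdorff_least:
  "(\<And>\<delta>. 0 < \<delta> \<Longrightarrow> hausdorff_pre k \<delta> E \<le> X) \<Longrightarrow> hausdorff k E \<le> X"
  unfolding hausdorff_def by (intro SUP_least) auto

text \<open>A monotone sequence of scales is what allows the suprema of two sets to be added;
  starting at \<open>\<eta>\<close> keeps every scale below a prescribed gap.\<close>

lemma hausdorff_eq_SUP_seq:
  assumes "0 < \<eta>"
  shows "hausdorff k E = (SUP n. hausdorff_pre k (\<eta> / Suc n) E)"
proof (rule antisym)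
  show "(SUP n. hausdorff_pre k (\<eta> / Suc n) E) \<le> hausdorff k E"
    using assms by (intro SUP_least hausdorff_pre_le_hausdorff) simp
  show "hausdorff k E \<le> (SUP n. hausdorff_pre k (\<eta> / Suc n) E)"
  proof (rule hausdorff_least)
    fix \<delta> :: real assume "0 < \<delta>"
    then obtain n where "inverse (of_nat (Suc n)) < \<delta> / \<eta>"
      using assms reals_Archimedean[of "\<delta> / \<eta>"] by auto
    then have "\<eta> / Suc n \<le> \<delta>"
      using assms by (simp add: field_simps)
    then show "hausdorff_pre k \<delta> E \<le> (SUP n. hausdorff_pre k (\<eta> / Suc n) E)"
      using hausdorff_pre_antimono by (intro SUP_upper2[of n]) auto
  qed
qed

lemma hausdorff_gauge_empty [simp]: "hausdorff_gauge k {} = 0"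
  by (simp add: hausdorff_gauge_def)

text \<open>The last hypothesis is there for \<open>k = 0\<close>: a nonempty set then has gauge 1
  whatever its diameter, the empty set has gauge 0.\<close>

lemma hausdorff_gauge_mono:
  assumes "bounded U" "diameter U \<le> diameter V" "U \<noteq> {} \<Longrightarrow> V \<noteq> {}"
  shows "hausdorff_gauge k U \<le> hausdorff_gauge k V"
  using assms diameter_ge_0[OF assms(1)]
  by (cases "U = {}")
    (auto simp: hausdorff_gauge_def intro!: ennreal_leI mult_left_mono power_mono)

text \<open>Preimages of a cover of \<open>F\<close> under an expanding map do not have larger diameters.\<close>

lemma hausdorff_mono_expanding:
  assumes "f ` E \<subseteq> F" "\<And>x y. \<lbrakk>x \<in> E; y \<in> E\<rbrakk> \<Longrightarrow> dist x y \<le> dist (f x) (f y)"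
  shows "hausdorff k E \<le> hausdorff k F"
proof (rule hausdorff_least)
  fix \<delta> :: real assume "0 < \<delta>"
  have "hausdorff_pre k \<delta> E \<le> hausdorff_pre k \<delta> F"
  proof (rule hausdorff_pre_greatest)
    fix U assume U: "F \<subseteq> (\<Union>i. U i)" "\<And>i::nat. bounded (U i)" "\<And>i. diameter (U i) \<le> \<delta>"
    define V where "V i = E \<inter> f -` U i" for i
    have d: "dist x y \<le> diameter (U i)" if "x \<in> V i" "y \<in> V i" for x y i
      using that assms(2)[of x y] diameter_bounded_bound[OF U(2)[of i], of "f x" "f y"]
      unfolding V_def by force
    have bV: "bounded (V i)" for i
      using d bounded_two_points by blast
    have dV: "diameter (V i) \<le> diameter (U i)" for i
      using d diameter_ge_0[OF U(2)[of i]]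
      by (cases "V i = {}") (auto simp: diameter_def[of "V i"] intro!: cSUP_least)
    have "E \<subseteq> (\<Union>i. V i)"
    proof
      fix x assume "x \<in> E"
      then obtain i where "f x \<in> U i" using U(1) assms(1) by blast
      then show "x \<in> (\<Union>i. V i)" using \<open>x \<in> E\<close> by (auto simp: V_def)
    qed
    then have "hausdorff_pre k \<delta> E \<le> (\<Sum>i. hausdorff_gauge k (V i))"
      by (rule hausdorff_pre_le) (rule bV order_trans[OF dV U(3)])+
    also have "\<dots> \<le> (\<Sum>i. hausdorff_gauge k (U i))"
      using bV dV by (intro suminf_le hausdorff_gauge_mono) (auto simp: V_def)
    finally show "hausdorff_pre k \<delta> E \<le> (\<Sum>i. hausdorff_gauge k (U i))" .
  qed
  also have "\<dots> \<le> hausdorff k F"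
    using \<open>0 < \<delta>\<close> by (rule hausdorff_pre_le_hausdorff)
  finally show "hausdorff_pre k \<delta> E \<le> hausdorff k F" .
qed

lemma hausdorff_mono: "E \<subseteq> F \<Longrightarrow> hausdorff k E \<le> hausdorff k F"
  by (rule hausdorff_mono_expanding[where f = id]) auto

lemma hausdorff_empty [simp]: "hausdorff k {} = 0"
proof -
  have "hausdorff k {} \<le> 0"
  proof (rule hausdorff_least)
    fix \<delta> :: real assume "0 < \<delta>"
    then show "hausdorff_pre k \<delta> {} \<le> 0"
      using hausdorff_pre_le[of "{}" "\<lambda>i. {}" \<delta> k] by simp
  qed
  then show ?thesis by simp
qed

text \<open>Almost optimal covers of both sets are interleaved into one sequence, by the parity of
  the index; each may exceed the infimum by \<open>e / 2\<close>.\<close>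

lemma hausdorff_pre_Un: "hausdorff_pre k \<delta> (E \<union> F) \<le> hausdorff_pre k \<delta> E + hausdorff_pre k \<delta> F"
proof (rule ennreal_le_epsilon)
  fix e :: real assume fin: "hausdorff_pre k \<delta> E + hausdorff_pre k \<delta> F < top" and "0 < e"
  have ex: "\<exists>U. G \<subseteq> (\<Union>i. U i) \<and> (\<forall>i. bounded (U i) \<and> diameter (U i) \<le> \<delta>) \<and>
      (\<Sum>i. hausdorff_gauge k (U i)) < hausdorff_pre k \<delta> G + ennreal (e / 2)"
    if "hausdorff_pre k \<delta> G < top" for G :: "'a set"
  proof -
    have "hausdorff_pre k \<delta> G < hausdorff_pre k \<delta> G + ennreal (e / 2)"
      using that \<open>0 < e\<close> ennreal_add_left_cancel_less[of _ 0] by fastforce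
    then show ?thesis
      unfolding hausdorff_pre_def INF_less_iff by auto
  qed
  obtain U where U: "E \<subseteq> (\<Union>i. U i)" "\<forall>i. bounded (U i) \<and> diameter (U i) \<le> \<delta>"
      "(\<Sum>i. hausdorff_gauge k (U i)) < hausdorff_pre k \<delta> E + ennreal (e / 2)"
    using ex[of E] fin by auto
  obtain V where V: "F \<subseteq> (\<Union>i. V i)" "\<forall>i. bounded (V i) \<and> diameter (V i) \<le> \<delta>"
      "(\<Sum>i. hausdorff_gauge k (V i)) < hausdorff_pre k \<delta> F + ennreal (e / 2)"
    using ex[of F] fin by auto
  define W where "W n = (if even n then U (n div 2) else V (n div 2))" for n
  have "E \<union> F \<subseteq> (\<Union>i. W i)"
  proof
    fix x assume "x \<in> E \<union> F"
    then consider i where "x \<in> U i" | i where "x \<in> V i"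
      using U(1) V(1) by blast
    then show "x \<in> (\<Union>i. W i)"
    proof cases
      case (1 i)
      then have "x \<in> W (2 * i)" by (simp add: W_def)
      then show ?thesis by blast
    next
      case (2 i)
      then have "x \<in> W (2 * i + 1)" by (simp add: W_def)
      then show ?thesis by blast
    qed
  qed
  then have "hausdorff_pre k \<delta> (E \<union> F) \<le> (\<Sum>i. hausdorff_gauge k (W i))"
    using U(2) V(2) by (intro hausdorff_pre_le) (auto simp: W_def)
  also have "\<dots> \<le> (\<Sum>i. hausdorff_gauge k (U i)) + (\<Sum>i. hausdorff_gauge k (V i))"
  proof (rule suminf_le_const)
    fix n
    have "(\<Sum>i<n. hausdorff_gauge k (W i)) \<le> (\<Sum>i<2*n. hausdorff_gauge k (W i))"
      by (intro sum_mono2) auto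
    also have "\<dots> = (\<Sum>i<n. hausdorff_gauge k (U i)) + (\<Sum>i<n. hausdorff_gauge k (V i))"
      by (induction n) (simp_all add: W_def ac_simps)
    also have "\<dots> \<le> (\<Sum>i. hausdorff_gauge k (U i)) + (\<Sum>i. hausdorff_gauge k (V i))"
      by (intro add_mono sum_le_suminf) auto
    finally show "(\<Sum>i<n. hausdorff_gauge k (W i))
      \<le> (\<Sum>i. hausdorff_gauge k (U i)) + (\<Sum>i. hausdorff_gauge k (V i))" .
  qed simp
  also have "\<dots> \<le> (hausdorff_pre k \<delta> E + ennreal (e / 2)) + (hausdorff_pre k \<delta> F + ennreal (e / 2))"
    using U(3) V(3) by (intro add_mono) auto
  also have "\<dots> = hausdorff_pre k \<delta> E + hausdorff_pre k \<delta> F + (ennreal (e / 2) + ennreal (e / 2))"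
    by (simp add: ac_simps)
  also have "ennreal (e / 2) + ennreal (e / 2) = ennreal e"
    using \<open>0 < e\<close> by (simp flip: ennreal_plus)
  finally show "hausdorff_pre k \<delta> (E \<union> F) \<le> hausdorff_pre k \<delta> E + hausdorff_pre k \<delta> F + ennreal e" .
qed

lemma hausdorff_Un: "hausdorff k (E \<union> F) \<le> hausdorff k E + hausdorff k F"
proof (rule hausdorff_least)
  fix \<delta> :: real assume "0 < \<delta>"
  then show "hausdorff_pre k \<delta> (E \<union> F) \<le> hausdorff k E + hausdorff k F"
    using hausdorff_pre_Un order_trans add_mono hausdorff_pre_le_hausdorff by metis
qed

lemma hausdorff_UN:
  "finite I \<Longrightarrow> hausdorff k (\<Union>i\<in>I. E i) \<le> (\<Sum>i\<in>I. hausdorff k (E i))"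
proof (induction I rule: finite_induct)
  case (insert i I)
  have "hausdorff k (\<Union>i\<in>insert i I. E i) \<le> hausdorff k (E i) + hausdorff k (\<Union>i\<in>I. E i)"
    using hausdorff_Un by simp
  also have "\<dots> \<le> hausdorff k (E i) + (\<Sum>i\<in>I. hausdorff k (E i))"
    using insert.IH by (intro add_left_mono)
  finally show ?case using insert by simp
qed simp

text \<open>A set of diameter at most \<open>\<eta>\<close> cannot meet both sides of the gap. So at
  every scale up to \<open>\<eta>\<close> a cover of the union splits into a cover of
  \<open>E\<close> and a cover of \<open>F\<close> without sharing a member.\<close>

lemma hausdorff_Un_separated:
  assumes "0 < \<eta>" "\<And>x y. \<lbrakk>x \<in> E; y \<in> F\<rbrakk> \<Longrightarrow> \<eta> < dist x y"
  shows "hausdorff k E + hausdorff k F \<le> hausdorff k (E \<union> F)"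
proof -
  have *: "hausdorff_pre k \<delta> E + hausdorff_pre k \<delta> F \<le> hausdorff_pre k \<delta> (E \<union> F)"
    if "\<delta> \<le> \<eta>" for \<delta>
  proof (rule hausdorff_pre_greatest)
    fix U assume U: "E \<union> F \<subseteq> (\<Union>i. U i)" "\<And>i::nat. bounded (U i)" "\<And>i. diameter (U i) \<le> \<delta>"
    have "0 \<le> \<delta>"
      using U(3)[of 0] diameter_ge_0[OF U(2)[of 0]] by linarith
    define V where "V G i = (if U i \<inter> G = {} then {} else U i)" for G i
    have le: "hausdorff_pre k \<delta> G \<le> (\<Sum>i. hausdorff_gauge k (V G i))" if "G \<subseteq> (\<Union>i. U i)" for G
      using that U(2,3) \<open>0 \<le> \<delta>\<close> by (intro hausdorff_pre_le) (fastforce simp: V_def)+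
    have disj: "U i \<inter> E = {} \<or> U i \<inter> F = {}" for i
    proof (rule ccontr)
      assume "\<not> ?thesis"
      then obtain x y where "x \<in> U i" "x \<in> E" "y \<in> U i" "y \<in> F" by blast
      then show False
        using assms(2)[of x y] diameter_bounded_bound[OF U(2), of x i y] U(3)[of i] that by simp
    qed
    have "hausdorff_pre k \<delta> E + hausdorff_pre k \<delta> F
        \<le> (\<Sum>i. hausdorff_gauge k (V E i)) + (\<Sum>i. hausdorff_gauge k (V F i))"
      using U(1) by (intro add_mono le) auto
    also have "\<dots> = (\<Sum>i. hausdorff_gauge k (V E i) + hausdorff_gauge k (V F i))"
      by (rule suminf_add) auto
    also have "\<dots> \<le> (\<Sum>i. hausdorff_gauge k (U i))"
      using disj by (intro suminf_le) (auto simp: V_def)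
    finally show "hausdorff_pre k \<delta> E + hausdorff_pre k \<delta> F \<le> (\<Sum>i. hausdorff_gauge k (U i))" .
  qed
  have inc: "incseq (\<lambda>n. hausdorff_pre k (\<eta> / Suc n) G)" for G :: "'a set"
    using assms(1) by (intro incseq_SucI hausdorff_pre_antimono) (simp add: field_simps)
  have "hausdorff k E + hausdorff k F
      = (SUP n. hausdorff_pre k (\<eta> / Suc n) E + hausdorff_pre k (\<eta> / Suc n) F)"
    unfolding hausdorff_eq_SUP_seq[OF assms(1)] by (rule ennreal_SUP_add[OF inc inc, symmetric])
  also have "\<dots> \<le> (SUP n. hausdorff_pre k (\<eta> / Suc n) (E \<union> F))"
  proof (intro SUP_mono' *)
    show "\<eta> / real (Suc n) \<le> \<eta>" for n
      using assms(1) by (simp add: field_simps)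
  qed
  also have "\<dots> = hausdorff k (E \<union> F)"
    by (rule hausdorff_eq_SUP_seq[OF assms(1), symmetric])
  finally show ?thesis .
qed

lemma hausdorff_Un_disjoint_compact:
  fixes E F :: "'a::heine_borel set"
  assumes "compact E" "compact F" "E \<inter> F = {}"
  shows "hausdorff k E + hausdorff k F \<le> hausdorff k (E \<union> F)"
proof -
  obtain d where "0 < d" "\<forall>x\<in>E. \<forall>y\<in>F. d \<le> dist x y"
    using separate_compact_closed[of E F] assms compact_imp_closed by blast
  then show ?thesis
    by (intro hausdorff_Un_separated[of "d / 2"]) force+
qed

lemma hausdorff_UN_disjoint_compact:
  fixes E :: "'i \<Rightarrow> 'a::heine_borel set"
  assumes "finite I" "\<And>i. i \<in> I \<Longrightarrow> compact (E i)" "disjoint_family_on E I"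
  shows "(\<Sum>i\<in>I. hausdorff k (E i)) \<le> hausdorff k (\<Union>i\<in>I. E i)"
  using assms
proof (induction I rule: finite_induct)
  case (insert i I)
  have "(\<Sum>i\<in>insert i I. hausdorff k (E i)) = hausdorff k (E i) + (\<Sum>i\<in>I. hausdorff k (E i))"
    using insert by simp
  also have "\<dots> \<le> hausdorff k (E i) + hausdorff k (\<Union>i\<in>I. E i)"
    using insert by (intro add_left_mono insert.IH) (auto simp: disjoint_family_on_def)
  also have "\<dots> \<le> hausdorff k (E i \<union> (\<Union>i\<in>I. E i))"
    using insert by (intro hausdorff_Un_disjoint_compact compact_UN) (auto simp: disjoint_family_on_def)
  finally show ?case by simp
qed simp

section \<open>Boxes\<close>

text \<open>A single set becomes a sequence when padded with empty sets, whose gauge is 0;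
  subadditivity of the premeasure then adds up the members of the cover.\<close>

lemma hausdorff_pre_finite_cover:
  assumes "finite I" "E \<subseteq> (\<Union>i\<in>I. U i)" "\<And>i. i \<in> I \<Longrightarrow> bounded (U i)"
    "\<And>i. i \<in> I \<Longrightarrow> diameter (U i) \<le> \<delta>" "0 \<le> \<delta>"
  shows "hausdorff_pre k \<delta> E \<le> (\<Sum>i\<in>I. hausdorff_gauge k (U i))"
  using assms
proof (induction I arbitrary: E rule: finite_induct)
  case empty
  then show ?case using hausdorff_pre_le[of E "\<lambda>i. {}" \<delta> k] by simp
next
  case (insert i I)
  have sums: "(\<lambda>n. hausdorff_gauge k (if n = 0 then U i else {})) sums hausdorff_gauge k (U i)"
    using sums_single[of 0 "\<lambda>n. hausdorff_gauge k (U i)"] by (simp add: if_distrib cong: if_cong)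
  have "hausdorff_pre k \<delta> (E \<inter> U i) \<le> (\<Sum>n. hausdorff_gauge k (if n = 0 then U i else {}))"
    using insert.prems by (intro hausdorff_pre_le) (auto split: if_splits)
  then have 1: "hausdorff_pre k \<delta> (E \<inter> U i) \<le> hausdorff_gauge k (U i)"
    by (simp only: sums_unique[OF sums, symmetric])
  have 2: "hausdorff_pre k \<delta> (E - U i) \<le> (\<Sum>i\<in>I. hausdorff_gauge k (U i))"
    using insert.prems by (intro insert.IH) auto
  have "hausdorff_pre k \<delta> E = hausdorff_pre k \<delta> ((E \<inter> U i) \<union> (E - U i))"
    by (simp add: Int_Diff_Un)
  also have "\<dots> \<le> hausdorff_gauge k (U i) + (\<Sum>i\<in>I. hausdorff_gauge k (U i))"
    using hausdorff_pre_Un add_mono[OF 1 2] order_trans by blast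
  finally show ?case using insert by simp
qed

section \<open>The measure of a box is finite, positive and linear in each side\<close>

lemma hausdorff_translation:
  fixes E :: "'a::real_normed_vector set"
  shows "hausdorff k ((+) a ` E) = hausdorff k E"
proof (rule antisym)
  show "hausdorff k ((+) a ` E) \<le> hausdorff k E"
    by (rule hausdorff_mono_expanding[where f = "\<lambda>x. x - a"]) auto
  show "hausdorff k E \<le> hausdorff k ((+) a ` E)"
    by (rule hausdorff_mono_expanding[where f = "(+) a"]) auto
qed

text \<open>Superadditivity comes only with a positive gap, so exact additivity is not at hand. But
  \<open>n + 1\<close> pieces of length \<open>t\<close> can be compared with unit pieces of the
  same total length at an error of at most \<open>2 * g 1\<close>, for every \<open>n\<close>. Such
  a bound on \<open>n + 1\<close> times the difference forces the difference to vanish.\<close>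

lemma linear_of_almost_additive:
  fixes g :: "real \<Rightarrow> real"
  assumes nonneg: "\<And>t. 0 < t \<Longrightarrow> 0 \<le> g t"
    and mono: "\<And>s t. \<lbrakk>0 < s; s \<le> t\<rbrakk> \<Longrightarrow> g s \<le> g t"
    and sub: "\<And>s t. \<lbrakk>0 < s; 0 < t\<rbrakk> \<Longrightarrow> g (s + t) \<le> g s + g t"
    and sup: "\<And>s t \<delta>. \<lbrakk>0 < s; 0 < t; 0 < \<delta>\<rbrakk> \<Longrightarrow> g s + g t \<le> g (s + t + \<delta>)"
    and "0 < t"
  shows "g t = t * g 1"
proof -
  have le: "g (real (Suc n) * s) \<le> real (Suc n) * g s" if "0 < s" for n s
  proof (induction n)
    case (Suc n)
    have "g (real (Suc (Suc n)) * s) \<le> g (real (Suc n) * s) + g s"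
      using sub[of "real (Suc n) * s" s] that by (simp add: algebra_simps add_pos_nonneg)
    then show ?case using Suc by (simp add: algebra_simps)
  qed simp
  have ge: "real (Suc n) * g s \<le> g (real (Suc n) * s + \<delta>)" if "0 < s" "0 < \<delta>" for n s \<delta>
    using \<open>0 < \<delta>\<close>
  proof (induction n arbitrary: \<delta>)
    case 0
    then show ?case using mono[of s "s + \<delta>"] that by simp
  next
    case (Suc n)
    have "real (Suc (Suc n)) * g s \<le> g (real (Suc n) * s + \<delta> / 2) + g s"
      using Suc.IH[of "\<delta> / 2"] Suc.prems by (simp add: algebra_simps)
    also have "\<dots> \<le> g (real (Suc n) * s + \<delta> / 2 + s + \<delta> / 2)"
      using that Suc.prems by (intro sup) (auto intro!: add_pos_pos)
    also have "real (Suc n) * s + \<delta> / 2 + s + \<delta> / 2 = real (Suc (Suc n)) * s + \<delta>"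
      by (simp add: algebra_simps)
    finally show ?case .
  qed
  have bound: "real (Suc n) * \<bar>g t - t * g 1\<bar> \<le> 2 * g 1" for n
  proof -
    define x where "x = real (Suc n) * t"
    have "0 < x" using \<open>0 < t\<close> by (simp add: x_def)
    have g1: "0 \<le> g 1" by (simp add: nonneg)
    have up: "real (Suc n) * g t \<le> (x + 2) * g 1"
    proof -
      \<comment> \<open>One unit beyond \<open>x\<close> is spent on the gap, and rounding up to an
        integer costs at most one more.\<close>
      obtain M where M: "real (Suc M) \<le> x + 2" "x + 1 \<le> real (Suc M)"
      proof (rule that[of "nat \<lceil>x\<rceil>"])
        show "real (Suc (nat \<lceil>x\<rceil>)) \<le> x + 2" "x + 1 \<le> real (Suc (nat \<lceil>x\<rceil>))"
          using \<open>0 < x\<close> by linarith+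
      qed
      have "real (Suc n) * g t \<le> g (x + 1)"
        using ge[of t 1 n] \<open>0 < t\<close> by (simp add: x_def)
      also have "\<dots> \<le> g (real (Suc M) * 1)"
        using M \<open>0 < x\<close> by (intro mono) auto
      also have "\<dots> \<le> real (Suc M) * g 1"
        by (rule le) simp
      also have "\<dots> \<le> (x + 2) * g 1"
        using M g1 by (intro mult_right_mono)
      finally show ?thesis .
    qed
    have low: "(x - 2) * g 1 \<le> real (Suc n) * g t"
    proof (cases "x \<le> 2")
      case True
      then have "(x - 2) * g 1 \<le> 0" using g1 by (simp add: mult_nonpos_nonneg)
      also have "0 \<le> real (Suc n) * g t" using nonneg \<open>0 < t\<close> by simp
      finally show ?thesis .
    next
      case False
      \<comment> \<open>Here \<open>\<lfloor>x\<rfloor> \<ge> 2\<close>, so the natural subtraction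
        is exact and \<open>Suc M\<close> is \<open>\<lfloor>x\<rfloor> - 1\<close>; this leaves one
        unit below \<open>x\<close> for the gap.\<close>
      then obtain M where M: "x - 2 \<le> real (Suc M)" "real (Suc M) + 1 \<le> x"
      proof (intro that[of "nat \<lfloor>x\<rfloor> - 2"])
        show "x - 2 \<le> real (Suc (nat \<lfloor>x\<rfloor> - 2))" "real (Suc (nat \<lfloor>x\<rfloor> - 2)) + 1 \<le> x"
          using False by linarith+
      qed
      have "(x - 2) * g 1 \<le> real (Suc M) * g 1"
        using M g1 by (intro mult_right_mono)
      also have "\<dots> \<le> g (real (Suc M) * 1 + 1)"
        by (rule ge) auto
      also have "\<dots> \<le> g x"
        using M by (intro mono) auto
      also have "\<dots> \<le> real (Suc n) * g t"
        unfolding x_def using \<open>0 < t\<close> by (rule le)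
      finally show ?thesis .
    qed
    have "real (Suc n) * (g t - t * g 1) = real (Suc n) * g t - x * g 1"
      by (simp add: x_def algebra_simps)
    then have "real (Suc n) * \<bar>g t - t * g 1\<bar> = \<bar>real (Suc n) * g t - x * g 1\<bar>"
      by (metis abs_mult abs_of_nat)
    then show ?thesis
      using up low by (simp add: abs_le_iff algebra_simps)
  qed
  show ?thesis
  proof (rule ccontr)
    assume "g t \<noteq> t * g 1"
    then obtain n where "2 * g 1 < real n * \<bar>g t - t * g 1\<bar>"
      using reals_Archimedean3[of "\<bar>g t - t * g 1\<bar>"] by auto
    also have "\<dots> \<le> real (Suc n) * \<bar>g t - t * g 1\<bar>"
      by (intro mult_right_mono) auto
    finally show False using bound[of n] by simp
  qed
qed

text \<open>A grid of \<open>m ^ k\<close> cells of side \<open>r / m\<close> covers the box, and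
  the l1 norm bounds the diameter of a cell by \<open>k * r / m\<close>. The powers of
  \<open>m\<close> cancel in the total gauge, so the same bound holds at every scale.\<close>

lemma hausdorff_cbox_finite:
  fixes s :: "'n::finite \<Rightarrow> real"
  assumes "\<And>i. i \<notin> D \<Longrightarrow> s i = 0"
  shows "hausdorff (card D) (cbox 0 (vec_lambda s)) < top"
proof -
  define k where "k = card D"
  \<comment> \<open>The inserted 1 keeps \<open>r\<close> positive when no side is.\<close>
  define r where "r = Max (insert 1 (range s))"
  have r: "0 < r" "s i \<le> r" for i
    using Max_ge[of "insert 1 (range s)" 1] Max_ge[of "insert 1 (range s)" "s i"]
    by (auto simp: r_def)
  have split: "\<exists>j<m. r * real j / real m \<le> t \<and> t \<le> r * (real j + 1) / real m"
    if "0 \<le> t" "t \<le> r" "0 < m" for t and m :: nat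
  proof (cases "t = r")
    case True
    \<comment> \<open>At the right end point the floor would give \<open>m\<close>, one past the
      last cell.\<close>
    then show ?thesis using that r by (intro exI[of _ "m - 1"]) (auto simp: field_simps)
  next
    case False
    define j where "j = nat \<lfloor>t * m / r\<rfloor>"
    have "0 \<le> t * m / r" using that r by simp
    then have j: "real j \<le> t * m / r" "t * m / r < real j + 1"
      by (auto simp: j_def)
    have "t * m / r < m" using False that r by (simp add: field_simps)
    then have "j < m" using j by linarith
    then show ?thesis
      using j that r by (intro exI[of _ j]) (auto simp: field_simps)
  qed
  define c where "c = unit_ball_vol (real k) * (k * r / 2) ^ k"
  have "hausdorff k (cbox 0 (vec_lambda s)) \<le> ennreal c"
  proof (rule hausdorff_least)
    fix \<delta> :: real assume "0 < \<delta>"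
    obtain m :: nat where m: "k * r / \<delta> < m" using reals_Archimedean2 by blast
    have "0 \<le> k * r / \<delta>" using r \<open>0 < \<delta>\<close> by simp
    then have "0 < m" using m by linarith
    have m\<delta>: "k * r / m \<le> \<delta>" using m \<open>0 < m\<close> \<open>0 < \<delta>\<close> by (simp add: field_simps)
    define Q where "Q f = cbox (\<chi> i. if i \<in> D then r * real (f i) / m else 0)
      (\<chi> i. if i \<in> D then r * (real (f i) + 1) / m else 0)" for f :: "'n \<Rightarrow> nat"
    have dQ: "diameter (Q f) \<le> k * r / m" for f
    proof (rule diameter_le)
      show "Q f \<noteq> {} \<or> 0 \<le> k * r / m" using r by simp
      fix x y assume xy: "x \<in> Q f" "y \<in> Q f"
      have "\<bar>(x - y) $ i\<bar> \<le> (if i \<in> D then r / m else 0)" for i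
      proof (cases "i \<in> D")
        case True
        then have "r * real (f i) / m \<le> x $ i" "x $ i \<le> r * (real (f i) + 1) / m"
          "r * real (f i) / m \<le> y $ i" "y $ i \<le> r * (real (f i) + 1) / m"
          using xy by (auto simp: Q_def mem_box_cart split: if_splits dest!: spec[of _ i])
        then show ?thesis using True
          by (simp add: distrib_left add_divide_distrib abs_le_iff)
      next
        case False
        then have "x $ i = 0" "y $ i = 0"
          using xy by (auto simp: Q_def mem_box_cart intro: antisym split: if_splits dest!: spec[of _ i])
        then show ?thesis using False by simp
      qed
      then have "(\<Sum>i\<in>UNIV. \<bar>(x - y) $ i\<bar>) \<le> (\<Sum>i\<in>UNIV. if i \<in> D then r / m else 0)"
        by (intro sum_mono)
      also have "\<dots> = k * r / m" by (simp add: sum.If_cases k_def)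
      finally show "norm (x - y) \<le> k * r / m"
        using norm_le_l1_cart[of "x - y"] by linarith
    qed
    have gQ: "hausdorff_gauge k (Q f) \<le> ennreal (unit_ball_vol k * (k * r / m / 2) ^ k)" for f
      using dQ[of f] diameter_ge_0[of "Q f"]
      by (auto simp: hausdorff_gauge_def Q_def bounded_cbox intro!: ennreal_leI mult_left_mono power_mono)
    have "cbox 0 (vec_lambda s) \<subseteq> (\<Union>f\<in>D \<rightarrow>\<^sub>E {..<m}. Q f)"
    proof
      fix v assume v: "v \<in> cbox 0 (vec_lambda s)"
      have "\<forall>i\<in>D. \<exists>j<m. r * real j / m \<le> v $ i \<and> v $ i \<le> r * (real j + 1) / m"
        using v order_trans[OF _ r(2)] \<open>0 < m\<close> by (intro ballI split) (auto simp: mem_box_cart)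
      then obtain f where f: "\<forall>i\<in>D. f i < m \<and> r * real (f i) / m \<le> v $ i \<and> v $ i \<le> r * (real (f i) + 1) / m"
        by metis
      have "v $ i = 0" if "i \<notin> D" for i
        using v assms[OF that] by (simp add: mem_box_cart) (metis antisym)
      then have "v \<in> Q (restrict f D)"
        using f by (auto simp: Q_def mem_box_cart)
      moreover have "restrict f D \<in> D \<rightarrow>\<^sub>E {..<m}" using f by auto
      ultimately show "v \<in> (\<Union>f\<in>D \<rightarrow>\<^sub>E {..<m}. Q f)" by blast
    qed
    then have "hausdorff_pre k \<delta> (cbox 0 (vec_lambda s)) \<le> (\<Sum>f\<in>D \<rightarrow>\<^sub>E {..<m}. hausdorff_gauge k (Q f))"
      using \<open>0 < \<delta>\<close> order_trans[OF dQ m\<delta>]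
      by (intro hausdorff_pre_finite_cover) (auto simp: Q_def bounded_cbox finite_PiE)
    also have "\<dots> \<le> (\<Sum>f\<in>D \<rightarrow>\<^sub>E {..<m}. ennreal (unit_ball_vol k * (k * r / m / 2) ^ k))"
      by (intro sum_mono gQ)
    also have "\<dots> = ennreal (m ^ k * (unit_ball_vol k * (k * r / m / 2) ^ k))"
      using r by (simp add: card_PiE k_def ennreal_mult ennreal_of_nat_eq_real_of_nat flip: of_nat_power)
    also have "m ^ k * (unit_ball_vol k * (k * r / m / 2) ^ k) = c"
      using \<open>0 < m\<close> by (simp add: c_def power_divide)
    finally show "hausdorff_pre k \<delta> (cbox 0 (vec_lambda s)) \<le> ennreal c" .
  qed
  then show ?thesis by (auto simp: k_def less_top[symmetric] top_unique)
qed

text \<open>Cylinders over the cubes circumscribed to the sets of a cover have Lebesgue measure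
  proportional to the gauge, and they cover a full-dimensional unit cube.\<close>

lemma hausdorff_unit_cube_pos:
  fixes D :: "'n::finite set"
  shows "0 < hausdorff (card D) (cbox 0 (vec_lambda (indicator D)) :: (real ^ 'n) set)"
proof -
  define k where "k = card D"
  define \<omega> where "\<omega> = unit_ball_vol (real k)"
  have \<omega>: "0 < \<omega>" by (simp add: \<omega>_def)
  let ?E = "cbox 0 (vec_lambda (indicator D)) :: (real ^ 'n) set"
  have "ennreal (\<omega> / 4 ^ k) \<le> hausdorff_pre k 1 ?E"
  proof (rule hausdorff_pre_greatest)
    fix U :: "nat \<Rightarrow> (real ^ 'n) set"
    assume U: "?E \<subseteq> (\<Union>i. U i)" "\<And>i. bounded (U i)" "\<And>i. diameter (U i) \<le> 1"
    define d where "d i = diameter (U i)" for i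
    have d: "0 \<le> d i" for i using U(2) by (simp add: d_def diameter_ge_0)
    define p where "p i = (SOME x. x \<in> U i)" for i
    have p: "p i \<in> U i" if "U i \<noteq> {}" for i
      using that by (simp add: p_def some_in_eq)
    \<comment> \<open>Around a chosen point of \<open>U i\<close> a cube of half side
      \<open>d i\<close> in the directions of \<open>D\<close>, and the full unit interval in the
      others. Its volume \<open>(2 * d i) ^ k\<close> is \<open>4 ^ k\<close> times the power
      \<open>(d i / 2) ^ k\<close> in the gauge, whence the constant
      \<open>4 ^ k / \<omega>\<close>.\<close>
    define W where "W i = (if U i = {} then {} else
      cbox (\<chi> j. if j \<in> D then p i $ j - d i else 0) (\<chi> j. if j \<in> D then p i $ j + d i else 1))" for i
    have eW: "emeasure lborel (W i) \<le> ennreal (4 ^ k / \<omega>) * hausdorff_gauge k (U i)" for i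
    proof (cases "U i = {}")
      case False
      define lo :: "real ^ 'n" where "lo = (\<chi> j. if j \<in> D then p i $ j - d i else 0)"
      define hi :: "real ^ 'n" where "hi = (\<chi> j. if j \<in> D then p i $ j + d i else 1)"
      have W: "W i = cbox lo hi"
        using False by (simp add: W_def lo_def hi_def)
      have "cbox lo hi \<noteq> {}"
        using d[of i] by (simp add: interval_ne_empty_cart lo_def hi_def)
      then have "measure lborel (W i) = (\<Prod>j\<in>UNIV. hi $ j - lo $ j)"
        unfolding W by (rule content_cbox_cart)
      also have "\<dots> = (\<Prod>j\<in>UNIV. if j \<in> D then 2 * d i else 1)"
        by (intro prod.cong) (auto simp: lo_def hi_def)
      also have "\<dots> = (2 * d i) ^ k"
        by (simp add: prod.If_cases k_def)
      also have "(2 * d i) ^ k = 4 ^ k * (d i / 2) ^ k"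
        using power_mult_distrib[of 4 "d i / 2" k] by simp
      also have "\<dots> = (4 ^ k / \<omega>) * (\<omega> * (d i / 2) ^ k)"
        using \<omega> by simp
      finally have "emeasure lborel (W i) = ennreal ((4 ^ k / \<omega>) * (\<omega> * (d i / 2) ^ k))"
        using emeasure_lborel_cbox_finite[of lo hi] by (simp add: W emeasure_eq_ennreal_measure less_top)
      also have "\<dots> = ennreal (4 ^ k / \<omega>) * hausdorff_gauge k (U i)"
        using False \<omega> d[of i] by (subst ennreal_mult) (auto simp: hausdorff_gauge_def \<omega>_def d_def)
      finally show ?thesis by simp
    qed (simp add: W_def)
    have sub: "cbox 0 1 \<subseteq> (\<Union>i. W i)"
    proof
      fix v :: "real ^ 'n" assume v: "v \<in> cbox 0 1"
      define w :: "real ^ 'n" where "w = (\<chi> j. if j \<in> D then v $ j else 0)"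
      have "w \<in> ?E" using v by (auto simp: w_def mem_box_cart)
      then obtain i where i: "w \<in> U i" using U(1) by blast
      then have "p i \<in> U i" using p by blast
      have "\<bar>w $ j - p i $ j\<bar> \<le> d i" for j
        using component_le_norm_cart[of "w - p i" j] i \<open>p i \<in> U i\<close>
          diameter_bounded_bound[OF U(2), of w i "p i"]
        by (simp add: d_def dist_norm)
      then have "v \<in> W i"
        using i v by (auto simp: W_def mem_box_cart w_def abs_le_iff algebra_simps split: if_splits)
          (smt (verit))+
      then show "v \<in> (\<Union>i. W i)" by blast
    qed
    have "measure lborel (cbox 0 1 :: (real ^ 'n) set) = 1"
      using content_cbox_cart[of "0 :: real ^ 'n" 1] by (simp add: interval_ne_empty_cart)
    then have "1 = emeasure lborel (cbox 0 1 :: (real ^ 'n) set)"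
      using emeasure_lborel_cbox_finite[of "0 :: real ^ 'n" 1]
      by (simp add: emeasure_eq_ennreal_measure less_top)
    also have "\<dots> \<le> emeasure lborel (\<Union>i. W i)"
      using sub by (intro emeasure_mono) (auto simp: W_def)
    also have "\<dots> \<le> (\<Sum>i. emeasure lborel (W i))"
      by (intro emeasure_subadditive_countably) (auto simp: W_def)
    also have "\<dots> \<le> (\<Sum>i. ennreal (4 ^ k / \<omega>) * hausdorff_gauge k (U i))"
      by (intro suminf_le eW) auto
    also have "\<dots> = ennreal (4 ^ k / \<omega>) * (\<Sum>i. hausdorff_gauge k (U i))"
      by simp
    finally have "ennreal (\<omega> / 4 ^ k) * 1
        \<le> ennreal (\<omega> / 4 ^ k) * (ennreal (4 ^ k / \<omega>) * (\<Sum>i. hausdorff_gauge k (U i)))"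
      by (rule mult_left_mono) simp
    also have "\<dots> = (\<Sum>i. hausdorff_gauge k (U i))"
      using \<omega> by (simp add: mult.assoc[symmetric] flip: ennreal_mult)
    finally show "ennreal (\<omega> / 4 ^ k) \<le> (\<Sum>i. hausdorff_gauge k (U i))" by simp
  qed
  also have "\<dots> \<le> hausdorff k ?E"
    by (rule hausdorff_pre_le_hausdorff) simp
  finally have "ennreal (\<omega> / 4 ^ k) \<le> hausdorff k ?E" .
  moreover have "0 < ennreal (\<omega> / 4 ^ k)"
    using \<omega> by simp
  ultimately show ?thesis
    unfolding k_def by (rule less_le_trans[rotated])
qed

text \<open>Two pieces of lengths \<open>a\<close> and \<open>b\<close>, placed end to end along
  direction \<open>j\<close>, cover the box of length \<open>a + b\<close>; moved apart by
  \<open>\<delta>\<close> they are disjoint compact sets inside the box of length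
  \<open>a + b + \<delta>\<close>. These are the two halves of almost additivity, and finiteness of
  the measure transfers them to the reals.\<close>

lemma hausdorff_cbox_scale:
  fixes s :: "'n::finite \<Rightarrow> real"
  assumes D: "\<And>i. i \<notin> D \<Longrightarrow> s i = 0" and "j \<in> D" "0 < t"
  shows "hausdorff (card D) (cbox 0 (vec_lambda (s(j := t))))
    = ennreal t * hausdorff (card D) (cbox 0 (vec_lambda (s(j := 1))))"
proof -
  define B where "B t = cbox 0 (vec_lambda (s(j := t)))" for t
  define H where "H = (hausdorff (card D) :: (real ^ 'n) set \<Rightarrow> ennreal)"
  have cB: "compact (B t)" for t by (simp add: B_def)
  have memB: "v \<in> B t \<longleftrightarrow> 0 \<le> v $ j \<and> v $ j \<le> t \<and> (\<forall>i. i \<noteq> j \<longrightarrow> 0 \<le> v $ i \<and> v $ i \<le> s i)" for v t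
    by (auto simp: B_def mem_box_cart)
  have fin: "H (B t) < top" for t
    unfolding B_def H_def using D \<open>j \<in> D\<close> by (intro hausdorff_cbox_finite) auto
  define g where "g t = enn2real (H (B t))" for t
  have eg: "H (B t) = ennreal (g t)" for t
    using fin[of t] by (simp add: g_def less_top)
  have g0: "0 \<le> g t" for t by (simp add: g_def)
  have memT: "v \<in> (+) (axis j a) ` B b \<longleftrightarrow> v - axis j a \<in> B b" for v a b
    by (auto simp: image_iff) (metis add_diff_cancel_left' diff_add_cancel add.commute)
  have "g t = t * g 1"
  proof (rule linear_of_almost_additive[OF g0 _ _ _ \<open>0 < t\<close>])
    fix a b :: real assume "0 < a" "a \<le> b"
    then have "H (B a) \<le> H (B b)"
      unfolding H_def by (intro hausdorff_mono) (auto simp: memB)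
    then show "g a \<le> g b" using g0 by (simp add: eg)
  next
    fix a b :: real assume "0 < a" "0 < b"
    have "B (a + b) \<subseteq> B a \<union> (+) (axis j a) ` B b"
      unfolding subset_iff Un_iff memT by (auto simp: memB axis_def)
    then have "H (B (a + b)) \<le> H (B a) + H ((+) (axis j a) ` B b)"
      unfolding H_def by (meson hausdorff_mono hausdorff_Un order_trans)
    then show "g (a + b) \<le> g a + g b"
      using g0 by (simp add: H_def hausdorff_translation) (simp add: eg flip: H_def ennreal_plus)
  next
    fix a b \<delta> :: real assume "0 < a" "0 < b" "0 < \<delta>"
    let ?T = "(+) (axis j (a + \<delta>)) ` B b"
    have "H (B a) + H ?T \<le> H (B a \<union> ?T)"
      unfolding H_def using cB \<open>0 < \<delta>\<close>
      by (intro hausdorff_Un_disjoint_compact compact_translation) (auto simp: memT memB axis_def)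
    also have "\<dots> \<le> H (B (a + b + \<delta>))"
      unfolding H_def using \<open>0 < a\<close> \<open>0 < b\<close> \<open>0 < \<delta>\<close>
      by (intro hausdorff_mono) (auto simp: memT memB axis_def split: if_splits)
    finally show "g a + g b \<le> g (a + b + \<delta>)"
      using g0 by (simp add: H_def hausdorff_translation) (simp add: eg flip: H_def ennreal_plus)
  qed
  then show ?thesis
    using eg[of t] eg[of 1] g0 \<open>0 < t\<close> by (simp add: B_def H_def ennreal_mult)
qed

lemma hausdorff_cbox:
  fixes s :: "'n::finite \<Rightarrow> real"
  assumes D: "\<And>i. i \<notin> D \<Longrightarrow> s i = 0" and pos: "\<And>i. i \<in> D \<Longrightarrow> 0 < s i"
  shows "hausdorff (card D) (cbox 0 (vec_lambda s))
    = ennreal (\<Prod>i\<in>D. s i) * hausdorff (card D) (cbox 0 (vec_lambda (indicator D) :: real ^ 'n))"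
proof -
  define H where "H s = hausdorff (card D) (cbox 0 (vec_lambda s))" for s :: "'n \<Rightarrow> real"
  \<comment> \<open>Sides are rescaled one at a time; the coordinates in \<open>D\<close> but not
    yet in \<open>B\<close> still have length 1.\<close>
  have "H (\<lambda>i. if i \<in> B then s i else indicator D i) = ennreal (\<Prod>i\<in>B. s i) * H (indicator D)"
    if "finite B" "B \<subseteq> D" for B
    using that
  proof (induction B rule: finite_induct)
    case empty
    then show ?case by simp
  next
    case (insert j B)
    let ?f = "\<lambda>i. if i \<in> B then s i else indicator D i"
    have 1: "(\<lambda>i. if i \<in> insert j B then s i else indicator D i) = ?f(j := s j)"
      by auto
    have 2: "?f(j := 1) = ?f"
      using insert by (auto simp: fun_eq_iff)
    have "H (?f(j := s j)) = ennreal (s j) * H (?f(j := 1))"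
      unfolding H_def using insert.prems D pos
      by (intro hausdorff_cbox_scale) (auto simp: indicator_def)
    moreover have "0 \<le> (\<Prod>i\<in>B. s i)"
      using insert.prems pos by (intro prod_nonneg) (auto intro: less_imp_le)
    ultimately show ?case
      using insert pos[of j] by (simp only: 1 2) (simp add: ennreal_mult mult.assoc)
  qed
  from this[of D] have "H (\<lambda>i. if i \<in> D then s i else indicator D i)
      = ennreal (\<Prod>i\<in>D. s i) * H (indicator D)" by simp
  moreover have "(\<lambda>i. if i \<in> D then s i else indicator D i) = s"
    using D by (auto simp: fun_eq_iff)
  ultimately show ?thesis by (simp add: H_def)
qed

section \<open>A common unit of measure for the facets of boxes\<close>

lemma dist_vec_le_iff:
  fixes v w :: "real ^ 'n::finite" and v' w' :: "real ^ 'm::finite"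
  shows "dist v w \<le> dist v' w' \<longleftrightarrow> (\<Sum>i\<in>UNIV. (v $ i - w $ i)\<^sup>2) \<le> (\<Sum>i\<in>UNIV. (v' $ i - w' $ i)\<^sup>2)"
  by (simp add: dist_vec_def L2_set_def dist_real_def)

text \<open>Permuting coordinates preserves distances. One inequality suffices, because the
  comparison of two facets applies it with the two indices in either order.\<close>

lemma hausdorff_cbox_permute:
  fixes s :: "'n::finite \<Rightarrow> real"
  assumes "bij \<pi>"
  shows "hausdorff k (cbox 0 (vec_lambda s)) \<le> hausdorff k (cbox 0 (vec_lambda (s \<circ> \<pi>)))"
proof (rule hausdorff_mono_expanding[where f = "\<lambda>v. \<chi> i. v $ \<pi> i"])
  show "(\<lambda>v. \<chi> i. v $ \<pi> i) ` cbox 0 (vec_lambda s) \<subseteq> cbox 0 (vec_lambda (s \<circ> \<pi>))"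
    by (auto simp: mem_box_cart)
  show "dist v w \<le> dist (\<chi> i. v $ \<pi> i) (\<chi> i. w $ \<pi> i)" for v w :: "real ^ 'n"
    using sum.reindex_bij_betw[OF assms, of "\<lambda>i. (v $ i - w $ i)\<^sup>2"] by (simp add: dist_vec_le_iff)
qed

text \<open>This is the factor by which the measure of codimension one differs from the product of
  side lengths. The index selects a facet of the cube, but the value is the same for all of
  them.\<close>

definition unit_facet_measure :: "'n::finite \<Rightarrow> ennreal" where
  "unit_facet_measure j =
     hausdorff (CARD('n) - 1) (cbox 0 (vec_lambda (indicator (- {j}))) :: (real ^ 'n) set)"

lemma card_Compl_singleton: "card (- {j :: 'n::finite}) = CARD('n) - 1"
  by (simp add: Compl_eq_Diff_UNIV)

lemma unit_facet_measure_eq: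
  fixes i j :: "'n::finite"
  shows "unit_facet_measure i = unit_facet_measure j"
proof -
  have "unit_facet_measure i \<le> unit_facet_measure j" for i j :: 'n
  proof -
    have "indicator (- {i}) \<circ> Transposition.transpose i j = (indicator (- {j}) :: 'n \<Rightarrow> real)"
      by (auto simp: fun_eq_iff indicator_def Transposition.transpose_def)
    then show ?thesis
      using hausdorff_cbox_permute[OF bij_transpose[of i j], of "CARD('n) - 1" "indicator (- {i})"]
      by (simp add: unit_facet_measure_def)
  qed
  then show ?thesis by (intro antisym)
qed

lemma unit_facet_measure_pos: "0 < unit_facet_measure j"
  using hausdorff_unit_cube_pos[of "- {j}"] by (simp add: unit_facet_measure_def card_Compl_singleton)

lemma unit_facet_measure_finite: "unit_facet_measure j < top"
  using hausdorff_cbox_finite[of "- {j}" "indicator (- {j})"]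
  by (simp add: unit_facet_measure_def card_Compl_singleton)

text \<open>The reference index \<open>i\<close> is independent of the direction \<open>j\<close> of
  the facet, so that areas of facets in different directions can be added.\<close>

lemma hausdorff_facet:
  fixes s :: "'n::finite \<Rightarrow> real" and i j :: 'n
  assumes "s j = 0" "\<And>i. i \<noteq> j \<Longrightarrow> 0 < s i"
  shows "hausdorff (CARD('n) - 1) (cbox 0 (vec_lambda s)) = ennreal (\<Prod>i\<in>- {j}. s i) * unit_facet_measure i"
  using hausdorff_cbox[of "- {j}" s] assms unit_facet_measure_eq[of i j]
  by (simp add: unit_facet_measure_def card_Compl_singleton)

lemma sum_UNIV_three:
  fixes f :: "'n::finite \<Rightarrow> 'a::ab_group_add"
  assumes "x \<noteq> y" "y \<noteq> z" "x \<noteq> z"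
  shows "sum f UNIV = f x + (f y + (f z + sum f (- {x, y, z})))"
proof -
  have "UNIV = insert x (insert y (insert z (- {x, y, z})))" by auto
  then have "sum f UNIV = sum f (insert x (insert y (insert z (- {x, y, z}))))" by simp
  also have "\<dots> = f x + (f y + (f z + sum f (- {x, y, z})))"
    using assms by simp
  finally show ?thesis .
qed

section \<open>Trapezoids and slanted facets\<close>

text \<open>A right trapezoid in the plane of \<open>y\<close> and \<open>z\<close>, with parallel
  sides \<open>b\<close> and \<open>b - q * h\<close> at distance \<open>h\<close>, times a unit
  cube; for \<open>q * h = b\<close> it degenerates to a right triangle. The lateral facets trimmed
  by the cut have this shape, and so has each half of the slanted facet once unfolded.\<close>

definition trapezoid :: "'n::finite \<Rightarrow> 'n \<Rightarrow> 'n \<Rightarrow> real \<Rightarrow> real \<Rightarrow> real \<Rightarrow> (real ^ 'n) set" where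
  "trapezoid x y z q b h = {v. v $ x = 0 \<and> 0 \<le> v $ z \<and> v $ z \<le> h \<and> q * v $ z \<le> v $ y \<and> v $ y \<le> b
     \<and> (\<forall>j. j \<notin> {x, y, z} \<longrightarrow> 0 \<le> v $ j \<and> v $ j \<le> 1)}"

text \<open>Two congruent copies of the trapezoid, separated by a gap of width \<open>\<delta>\<close> along their slanted
  sides, fit into a box; so no measurability or null sets are needed.\<close>

lemma hausdorff_trapezoid_le:
  fixes x y z i :: "'n::finite"
  assumes xyz: "x \<noteq> y" "y \<noteq> z" "x \<noteq> z" and "0 \<le> q" "0 < h" "q * h \<le> b" "0 < b"
  shows "hausdorff (CARD('n) - 1) (trapezoid x y z q b h)
    \<le> ennreal ((b - q * h / 2) * h) * unit_facet_measure i"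
proof -
  define T where "T = trapezoid x y z q b h"
  define H where "H = (hausdorff (CARD('n) - 1) :: (real ^ 'n) set \<Rightarrow> ennreal)"
  obtain \<kappa> where \<kappa>: "unit_facet_measure i = ennreal \<kappa>" "0 < \<kappa>"
    using unit_facet_measure_pos[of i] unit_facet_measure_finite[of i]
    by (cases "unit_facet_measure i") auto
  have gap: "2 * H T \<le> ennreal ((2 * b - q * h + \<delta>) * h * \<kappa>)" if "0 < \<delta>" for \<delta>
  proof -
    \<comment> \<open>A half turn in the plane of \<open>y\<close> and \<open>z\<close>, combined
      with a shift by \<open>\<delta>\<close>: it takes the slanted side
      \<open>v $ y = q * v $ z\<close> to the parallel line
      \<open>v $ y = q * v $ z - \<delta>\<close>, with the image on the far side of it.\<close>
    define f where "f v = (\<chi> j. if j = y then q * h - \<delta> - v $ y else if j = z then h - v $ z else v $ j)"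
      for v :: "real ^ 'n"
    define \<sigma> where "\<sigma> j = (if j = x then 0 else if j = y then 2 * b - q * h + \<delta> else if j = z then h else 1)" for j
    have "H T \<le> H (f ` T)"
      unfolding H_def
    proof (rule hausdorff_mono_expanding[where f = f])
      show "dist v w \<le> dist (f v) (f w)" for v w
        unfolding dist_vec_le_iff sum_UNIV_three[OF xyz] using xyz
        by (simp add: f_def power2_commute)
    qed simp
    have "2 * H T \<le> H T + H (f ` T)"
      using \<open>H T \<le> H (f ` T)\<close> by (simp add: mult_2 add_left_mono)
    also have "\<dots> \<le> H (T \<union> f ` T)"
      unfolding H_def
    proof (rule hausdorff_Un_separated)
      show "0 < \<delta> / (2 * (1 + q))" using that \<open>0 \<le> q\<close> by simp
      fix v w' assume "v \<in> T" "w' \<in> f ` T"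
      then obtain w where w: "w \<in> T" "w' = f w" by blast
      have "q * v $ z \<le> v $ y" "q * w $ z \<le> w $ y"
        using \<open>v \<in> T\<close> w by (auto simp: T_def trapezoid_def)
      \<comment> \<open>The functional \<open>v $ y - q * v $ z\<close> is nonnegative on
        \<open>T\<close>, at most \<open>- \<delta>\<close> on the copy, and Lipschitz with constant
        \<open>1 + q\<close>.\<close>
      then have "\<delta> \<le> (v - w') $ y - q * (v - w') $ z"
        using xyz by (simp add: w(2) f_def algebra_simps)
      also have "\<dots> \<le> dist v w' + q * dist v w'"
      proof -
        have "(v - w') $ y \<le> dist v w'" "- (v - w') $ z \<le> dist v w'"
          using component_le_norm_cart[of "v - w'"] by (metis abs_le_D1 abs_le_D2 dist_norm)+
        moreover from this have "q * (- (v - w') $ z) \<le> q * dist v w'"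
          using \<open>0 \<le> q\<close> by (intro mult_left_mono)
        ultimately show ?thesis by (simp add: right_diff_distrib)
      qed
      finally have "\<delta> \<le> (1 + q) * dist v w'" by (simp add: algebra_simps)
      moreover have "\<delta> / (2 * (1 + q)) < \<delta> / (1 + q)"
        using that \<open>0 \<le> q\<close> by (simp add: frac_less2)
      ultimately show "\<delta> / (2 * (1 + q)) < dist v w'"
        using \<open>0 \<le> q\<close> by (simp add: pos_divide_le_eq mult.commute order.strict_trans2)
    qed
    also have "\<dots> \<le> H (cbox 0 (vec_lambda \<sigma>))"
      unfolding H_def
    proof (rule hausdorff_mono_expanding[where f = "(+) (axis y (b - q * h + \<delta>))"])
      have "axis y (b - q * h + \<delta>) + w \<in> cbox 0 (vec_lambda \<sigma>)"
        if "v \<in> T" "w = v \<or> w = f v" for v w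
      proof -
        have v: "v $ x = 0" "0 \<le> v $ z" "v $ z \<le> h" "q * v $ z \<le> v $ y" "v $ y \<le> b"
          "\<And>j. j \<noteq> x \<Longrightarrow> j \<noteq> y \<Longrightarrow> j \<noteq> z \<Longrightarrow> 0 \<le> v $ j \<and> v $ j \<le> 1"
          using \<open>v \<in> T\<close> by (auto simp: T_def trapezoid_def)
        have "0 \<le> q * v $ z" using v \<open>0 \<le> q\<close> by simp
        then have "0 \<le> v $ y" using v by linarith
        show ?thesis
          using that(2) v \<open>0 \<le> v $ y\<close> \<open>q * h \<le> b\<close> \<open>0 < \<delta>\<close> xyz
          by (elim disjE) (auto simp: mem_box_cart axis_def f_def \<sigma>_def)
      qed
      then show "(+) (axis y (b - q * h + \<delta>)) ` (T \<union> f ` T) \<subseteq> cbox 0 (vec_lambda \<sigma>)"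
        by blast
    qed simp
    also have "\<dots> = ennreal (\<Prod>j\<in>- {x}. \<sigma> j) * unit_facet_measure i"
      unfolding H_def using that assms by (intro hausdorff_facet) (auto simp: \<sigma>_def)
    also have "(\<Prod>j\<in>- {x}. \<sigma> j) = (2 * b - q * h + \<delta>) * h"
    proof -
      have "- {x} = insert y (insert z (- {x, y, z}))" using xyz by auto
      then show ?thesis using xyz by (simp add: \<sigma>_def prod.neutral)
    qed
    also have "ennreal ((2 * b - q * h + \<delta>) * h) * unit_facet_measure i
        = ennreal ((2 * b - q * h + \<delta>) * h * \<kappa>)"
      using \<kappa> that assms by (simp add: ennreal_mult)
    finally show ?thesis .
  qed
  have "2 * H T < top"
    using gap[of 1] by (auto simp: less_top[symmetric] top_unique)
  then obtain t where t: "H T = ennreal t" "0 \<le> t"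
    by (cases "H T") (auto simp: ennreal_mult_less_top)
  have "2 * t \<le> (2 * b - q * h) * h * \<kappa> + e" if "0 < e" for e
  proof -
    \<comment> \<open>The gap width \<open>e / (h * \<kappa>)\<close> is chosen so that it
      contributes exactly \<open>e\<close> to the bound.\<close>
    have "2 * t \<le> (2 * b - q * h + e / (h * \<kappa>)) * h * \<kappa>"
    proof -
      have "0 < e / (h * \<kappa>)" using that \<kappa> assms by simp
      then have "ennreal (2 * t) \<le> ennreal ((2 * b - q * h + e / (h * \<kappa>)) * h * \<kappa>)"
        using gap[of "e / (h * \<kappa>)"] t by (simp add: ennreal_mult)
      moreover have "0 \<le> (2 * b - q * h + e / (h * \<kappa>)) * h * \<kappa>"
        using that \<kappa> assms by (intro mult_nonneg_nonneg add_nonneg_nonneg) auto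
      ultimately show ?thesis by simp
    qed
    also have "\<dots> = (2 * b - q * h) * h * \<kappa> + e"
      using \<kappa> assms by (simp add: distrib_right)
    finally show ?thesis .
  qed
  then have "2 * t \<le> (2 * b - q * h) * h * \<kappa>"
    by (rule field_le_epsilon)
  then have "t \<le> (b - q * h / 2) * h * \<kappa>"
    by (simp add: algebra_simps)
  then have "H T \<le> ennreal ((b - q * h / 2) * h * \<kappa>)"
    using t by (simp add: ennreal_leI)
  also have "\<dots> = ennreal ((b - q * h / 2) * h) * unit_facet_measure i"
    using \<kappa> assms by (simp add: ennreal_mult)
  finally show ?thesis by (simp add: H_def T_def)
qed

text \<open>The constant \<open>0.71\<close> is an upper approximation of \<open>1 / sqrt 2\<close>; so the map in the proof, which
  unfolds half of the slanted facet into a coordinate hyperplane, is only expanding instead of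
  isometric.\<close>

lemma hausdorff_slanted_half_le:
  fixes x y z i :: "'n::finite"
  assumes xyz: "x \<noteq> y" "y \<noteq> z" "x \<noteq> z" and "0 < q" "0 < h"
  shows "hausdorff (CARD('n) - 1) {v :: real ^ 'n. v $ x + v $ y = q * v $ z \<and> 0 \<le> v $ z \<and> v $ z \<le> h
      \<and> 0 \<le> v $ y \<and> v $ y \<le> v $ x \<and> (\<forall>j. j \<notin> {x, y, z} \<longrightarrow> 0 \<le> v $ j \<and> v $ j \<le> 1)}
    \<le> ennreal (0.355 * q * (1 + q) * h\<^sup>2) * unit_facet_measure i"
    (is "hausdorff _ ?S \<le> _")
proof -
  define c :: real where "c = 0.71"
  have c: "0 < c" "1 / 2 \<le> c\<^sup>2" by (simp_all add: c_def power2_eq_square)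
  define b h' q' where "b = c * q * h" and "h' = (1 + q) * h" and "q' = c * q / (1 + q)"
  have pos: "0 < b" "0 < h'" "0 < q'" "q' * h' = b" "q' * (1 + q) = c * q"
    using assms c by (simp_all add: b_def h'_def q'_def add_pos_pos)
  \<comment> \<open>The half facet is a right triangle with apex at \<open>v $ z = 0\<close>, turned
    upside down here. Its axis \<open>v $ x = v $ y\<close> goes to the vertical side
    \<open>y = b\<close> of the trapezoid, its edge \<open>v $ y = 0\<close> to the slanted
    side.\<close>
  define f where "f v = (\<chi> j. if j = x then 0 else if j = y then b - c * (v $ x - v $ y)
    else if j = z then h' - (1 + q) * v $ z else v $ j)" for v :: "real ^ 'n"
  have "hausdorff (CARD('n) - 1) ?S \<le> hausdorff (CARD('n) - 1) (trapezoid x y z q' b h')"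
  proof (rule hausdorff_mono_expanding[where f = f])
    show "f ` ?S \<subseteq> trapezoid x y z q' b h'"
    proof
      fix w assume "w \<in> f ` ?S"
      then obtain v where v: "v \<in> ?S" "w = f v" by blast
      then have v': "v $ x + v $ y = q * v $ z" "0 \<le> v $ z" "v $ z \<le> h" "0 \<le> v $ y" "v $ y \<le> v $ x"
        "\<And>j. j \<notin> {x, y, z} \<Longrightarrow> 0 \<le> v $ j \<and> v $ j \<le> 1" by auto
      have "(1 + q) * v $ z \<le> h'" "0 \<le> (1 + q) * v $ z"
        using v' assms by (auto simp: h'_def)
      moreover have "0 \<le> c * (v $ x - v $ y)"
        using v' c by simp
      moreover have "q' * (h' - (1 + q) * v $ z) \<le> b - c * (v $ x - v $ y)"
      proof -
        have "q' * (h' - (1 + q) * v $ z) = b - c * (q * v $ z)"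
          using pos by (simp add: right_diff_distrib mult.assoc[symmetric])
        then show ?thesis using v' c by (auto intro!: mult_left_mono)
      qed
      ultimately show "w \<in> trapezoid x y z q' b h'"
        using v' xyz by (auto simp: trapezoid_def v(2) f_def)
    qed
    show "dist v w \<le> dist (f v) (f w)" if "v \<in> ?S" "w \<in> ?S" for v w
    proof -
      define d where "d i = v $ i - w $ i" for i
      have d: "d x + d y = q * d z"
        using that by (simp add: d_def algebra_simps)
      have "(d x)\<^sup>2 + (d y)\<^sup>2 + (d z)\<^sup>2 = (d x + d y)\<^sup>2 / 2 + (d x - d y)\<^sup>2 / 2 + (d z)\<^sup>2"
        by (simp add: power2_eq_square field_simps)
      also have "\<dots> = (q\<^sup>2 / 2 + 1) * (d z)\<^sup>2 + (d x - d y)\<^sup>2 / 2"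
        by (simp add: d power_mult_distrib algebra_simps)
      \<comment> \<open>Up to here the identity is exact: a unit step in \<open>z\<close> along the
        axis of the facet has length sqrt (1 + q^2 / 2), and \<open>1 + q\<close> is an upper bound
        for it free of roots.\<close>
      also have "\<dots> \<le> (1 + q)\<^sup>2 * (d z)\<^sup>2 + c\<^sup>2 * (d x - d y)\<^sup>2"
      proof (intro add_mono mult_right_mono)
        show "q\<^sup>2 / 2 + 1 \<le> (1 + q)\<^sup>2"
          using \<open>0 < q\<close> by (simp add: power2_eq_square algebra_simps)
        show "(d x - d y)\<^sup>2 / 2 \<le> c\<^sup>2 * (d x - d y)\<^sup>2"
          using mult_right_mono[OF c(2), of "(d x - d y)\<^sup>2"] by simp
      qed simp
      finally have "(d x)\<^sup>2 + (d y)\<^sup>2 + (d z)\<^sup>2 \<le> (c * (d x - d y))\<^sup>2 + ((1 + q) * d z)\<^sup>2"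
        by (simp add: power_mult_distrib)
      moreover have "(f v $ y - f w $ y)\<^sup>2 = (c * (d x - d y))\<^sup>2"
        using xyz unfolding power2_eq_iff by (simp add: f_def d_def algebra_simps)
      moreover have "(f v $ z - f w $ z)\<^sup>2 = ((1 + q) * d z)\<^sup>2"
        using xyz unfolding power2_eq_iff by (simp add: f_def d_def algebra_simps)
      moreover have "f v $ x - f w $ x = 0" by (simp add: f_def)
      moreover have "(\<Sum>j\<in>- {x, y, z}. (f v $ j - f w $ j)\<^sup>2) = (\<Sum>j\<in>- {x, y, z}. (d j)\<^sup>2)"
        by (intro sum.cong) (auto simp: f_def d_def)
      ultimately show ?thesis
        unfolding dist_vec_le_iff sum_UNIV_three[OF xyz] d_def by simp
    qed
  qed
  also have "\<dots> \<le> ennreal ((b - q' * h' / 2) * h') * unit_facet_measure i"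
    using xyz pos by (intro hausdorff_trapezoid_le) auto
  also have "(b - q' * h' / 2) * h' = 0.355 * q * (1 + q) * h\<^sup>2"
    by (simp add: pos(4)) (simp add: b_def h'_def c_def power2_eq_square)
  finally show ?thesis .
qed

section \<open>Prisms and chamfered prisms\<close>

text \<open>The height 0 is allowed: \<open>prism z 0\<close> is the base, a unit cube inside the
  hyperplane orthogonal to \<open>axis z 1\<close>.\<close>

definition prism :: "'n::finite \<Rightarrow> real \<Rightarrow> (real ^ 'n) set" where
  "prism z h = cbox 0 (\<chi> j. if j = z then h else 1)"

lemma mem_prism: "v \<in> prism z h \<longleftrightarrow> (\<forall>j. 0 \<le> v $ j \<and> v $ j \<le> (if j = z then h else 1))"
  by (simp add: prism_def mem_box_cart)

lemma prism_minus_box: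
  assumes "v \<in> prism z h" "v \<notin> box 0 (\<chi> j. if j = z then h else 1)"
  obtains j where "v $ j = 0 \<or> v $ j = (if j = z then h else 1)"
proof -
  have "\<exists>j. \<not> (0 < v $ j \<and> v $ j < (if j = z then h else 1))"
    using assms(2) by (simp add: mem_box_cart)
  then obtain j where "\<not> (0 < v $ j \<and> v $ j < (if j = z then h else 1))" ..
  moreover have "0 \<le> v $ j \<and> v $ j \<le> (if j = z then h else 1)"
    using assms(1) unfolding mem_prism by (rule spec)
  ultimately have "v $ j = 0 \<or> v $ j = (if j = z then h else 1)"
    by linarith
  then show ?thesis by (rule that)
qed

section \<open>The boundary area of a prism\<close>

lemma hausdorff_prism_face_le:
  fixes i j z :: "'n::finite"
  assumes "0 < h"
  shows "hausdorff (CARD('n) - 1) {v \<in> prism z h. v $ j = t}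
    \<le> ennreal (if j = z then 1 else h) * unit_facet_measure i"
proof -
  define s where "s i = (if i = j then 0 else if i = z then h else 1)" for i
  have "hausdorff (CARD('n) - 1) {v \<in> prism z h. v $ j = t} \<le> hausdorff (CARD('n) - 1) (cbox 0 (vec_lambda s))"
  proof (rule hausdorff_mono_expanding[where f = "\<lambda>v. v - axis j t"])
    show "(\<lambda>v. v - axis j t) ` {v \<in> prism z h. v $ j = t} \<subseteq> cbox 0 (vec_lambda s)"
      by (auto simp: mem_prism mem_box_cart s_def axis_def)
  qed (simp add: dist_norm)
  also have "\<dots> = ennreal (\<Prod>i\<in>- {j}. s i) * unit_facet_measure i"
    using assms by (intro hausdorff_facet) (auto simp: s_def)
  also have "(\<Prod>i\<in>- {j}. s i) = (\<Prod>i\<in>- {j}. if i = z then h else 1)"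
    by (intro prod.cong) (auto simp: s_def)
  also have "\<dots> = (if j = z then 1 else h)"
    by simp
  finally show ?thesis .
qed

lemma frontier_prism_le:
  fixes z i :: "'n::finite"
  assumes "0 < h"
  shows "hausdorff (CARD('n) - 1) (frontier (prism z h))
    \<le> ennreal (2 + 2 * real (CARD('n) - 1) * h) * unit_facet_measure i"
proof -
  define E where "E p = {v \<in> prism z h. v $ fst p = (if snd p then (if fst p = z then h else 1) else 0)}"
    for p :: "'n \<times> bool"
  have "frontier (prism z h) \<subseteq> (\<Union>p\<in>UNIV. E p)"
  proof
    fix v assume "v \<in> frontier (prism z h)"
    then have v: "v \<in> prism z h" "v \<notin> box 0 (\<chi> j. if j = z then h else 1)"
      by (auto simp: prism_def frontier_cbox)
    then obtain j where "v $ j = 0 \<or> v $ j = (if j = z then h else 1)"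
      by (rule prism_minus_box)
    then have "v \<in> E (j, False) \<or> v \<in> E (j, True)"
      using v by (auto simp: E_def)
    then show "v \<in> (\<Union>p\<in>UNIV. E p)" by blast
  qed
  then have "hausdorff (CARD('n) - 1) (frontier (prism z h)) \<le> hausdorff (CARD('n) - 1) (\<Union>p\<in>UNIV. E p)"
    by (rule hausdorff_mono)
  also have "\<dots> \<le> (\<Sum>p\<in>UNIV. hausdorff (CARD('n) - 1) (E p))"
    by (rule hausdorff_UN) simp
  also have "\<dots> \<le> (\<Sum>p\<in>(UNIV :: ('n \<times> bool) set). ennreal (if fst p = z then 1 else h) * unit_facet_measure i)"
  proof (rule sum_mono)
    fix p :: "'n \<times> bool"
    show "hausdorff (CARD('n) - 1) (E p) \<le> ennreal (if fst p = z then 1 else h) * unit_facet_measure i"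
      unfolding E_def using assms by (rule hausdorff_prism_face_le)
  qed
  also have "\<dots> = ennreal (\<Sum>p\<in>(UNIV :: ('n \<times> bool) set). if fst p = z then 1 else h) * unit_facet_measure i"
    using assms by (simp add: sum_distrib_right[symmetric])
  also have "(\<Sum>p\<in>(UNIV :: ('n \<times> bool) set). if fst p = z then 1 else h)
      = (\<Sum>j\<in>UNIV. \<Sum>b\<in>(UNIV :: bool set). if j = z then 1 else h)"
    by (simp add: sum.cartesian_product case_prod_beta del: sum_constant)
  also have "\<dots> = 2 + 2 * real (CARD('n) - 1) * h"
    by (simp add: sum.If_cases Compl_eq_Diff_UNIV algebra_simps flip: sum_distrib_left)
  finally show ?thesis .
qed

text \<open>The lateral facets of the prism become disjoint after shrinking them by a factor \<open>1 - 2 * \<delta>\<close>.\<close>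

lemma frontier_prism_ge:
  fixes z i :: "'n::finite"
  assumes "0 < h" "2 \<le> CARD('n)"
  shows "ennreal (2 * real (CARD('n) - 1) * h) * unit_facet_measure i
    \<le> hausdorff (CARD('n) - 1) (frontier (prism z h))"
proof -
  obtain \<kappa> where \<kappa>: "unit_facet_measure i = ennreal \<kappa>" "0 < \<kappa>"
    using unit_facet_measure_pos[of i] unit_facet_measure_finite[of i]
    by (cases "unit_facet_measure i") auto
  have "hausdorff (CARD('n) - 1) (frontier (prism z h)) < top"
    using frontier_prism_le[OF assms(1), of z i] \<kappa> by (auto simp: less_top[symmetric] top_unique ennreal_mult_eq_top_iff)
  then obtain F where F: "hausdorff (CARD('n) - 1) (frontier (prism z h)) = ennreal F" "0 \<le> F"
    by (cases "hausdorff (CARD('n) - 1) (frontier (prism z h))") auto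
  let ?C = "2 * real (CARD('n) - 1) * h * \<kappa>"
  have shrunk: "?C * (1 - 2 * \<delta>) ^ (CARD('n) - 2) \<le> F" if \<delta>: "0 < \<delta>" "\<delta> < 1 / 2" for \<delta> :: real
  proof -
    \<comment> \<open>Bottom and top are left out: their area does not grow with the height, so they
      do not influence the limit.\<close>
    define I where "I = (- {z}) \<times> (UNIV :: bool set)"
    define s where "s p i = (if i = fst p then 0 else if i = z then h else 1 - 2 * \<delta>)" for p :: "'n \<times> bool" and i
    define a :: "'n \<times> bool \<Rightarrow> real ^ 'n"
      where "a p = (\<chi> i. if i = fst p then of_bool (snd p) else if i = z then 0 else \<delta>)" for p
    define E where "E p = (+) (a p) ` cbox 0 (vec_lambda (s p))" for p
    have E: "v $ fst p = of_bool (snd p)" "0 \<le> v $ z" "v $ z \<le> h"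
        "\<And>i. i \<noteq> fst p \<Longrightarrow> i \<noteq> z \<Longrightarrow> \<delta> \<le> v $ i \<and> v $ i \<le> 1 - \<delta>"
      if pI: "p \<in> I" and "v \<in> E p" for v p
    proof -
      obtain w where w: "v = a p + w" "\<And>i. 0 \<le> w $ i \<and> w $ i \<le> s p i"
        using \<open>v \<in> E p\<close> by (auto simp: E_def mem_box_cart)
      show "v $ fst p = of_bool (snd p)" "0 \<le> v $ z" "v $ z \<le> h"
        using w(2)[of "fst p"] w(2)[of z] pI by (auto simp: w(1) a_def s_def I_def)
      show "\<delta> \<le> v $ i \<and> v $ i \<le> 1 - \<delta>" if "i \<noteq> fst p" "i \<noteq> z" for i
        using w(2)[of i] that by (simp add: w(1) a_def s_def)
    qed
    have "disjoint_family_on E I"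
      unfolding disjoint_family_on_def
    proof (intro ballI impI)
      fix p p' assume p: "p \<in> I" "p' \<in> I" "p \<noteq> p'"
      show "E p \<inter> E p' = {}"
      proof (rule ccontr)
        assume "E p \<inter> E p' \<noteq> {}"
        then obtain v where v: "v \<in> E p" "v \<in> E p'" by blast
        show False
        proof (cases "fst p = fst p'")
          case True
          then have "snd p = snd p'" using E(1)[OF p(1) v(1)] E(1)[OF p(2) v(2)]
            by (cases "snd p"; cases "snd p'") auto
          then show False using True p(3) by (simp add: prod_eq_iff)
        next
          \<comment> \<open>The coordinate \<open>fst p\<close> is 0 or 1 on \<open>E p\<close>, but
            lies between \<open>\<delta>\<close> and \<open>1 - \<delta>\<close> on
            \<open>E p'\<close>.\<close>
          case False
          moreover have "fst p \<noteq> z" using p(1) by (auto simp: I_def)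
          ultimately show False
            using E(1)[OF p(1) v(1)] E(4)[OF p(2) v(2), of "fst p"] \<delta>
            by (cases "snd p") auto
        qed
      qed
    qed
    have HE: "hausdorff (CARD('n) - 1) (E p) = ennreal (h * (1 - 2 * \<delta>) ^ (CARD('n) - 2) * \<kappa>)" if "p \<in> I" for p
    proof -
      have "hausdorff (CARD('n) - 1) (E p) = ennreal (\<Prod>i\<in>- {fst p}. s p i) * unit_facet_measure i"
        unfolding E_def hausdorff_translation using \<open>0 < h\<close> \<delta>
        by (intro hausdorff_facet) (auto simp: s_def)
      also have "- {fst p} = insert z (- {fst p, z})" using that by (auto simp: I_def)
      also have "(\<Prod>i\<in>\<dots>. s p i) = s p z * (\<Prod>i\<in>- {fst p, z}. s p i)"
        by (rule prod.insert) auto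
      also have "(\<Prod>i\<in>- {fst p, z}. s p i) = (\<Prod>i\<in>- {fst p, z}. 1 - 2 * \<delta>)"
        by (intro prod.cong) (auto simp: s_def)
      also have "s p z = h" using that by (auto simp: s_def I_def)
      also have "(\<Prod>i\<in>- {fst p, z}. 1 - 2 * \<delta>) = (1 - 2 * \<delta>) ^ (CARD('n) - 2)"
      proof -
        have "fst p \<noteq> z" using that by (auto simp: I_def)
        then show ?thesis by (simp add: Compl_eq_Diff_UNIV card_Diff_subset numeral_2_eq_2)
      qed
      finally show ?thesis using \<kappa> \<delta> \<open>0 < h\<close> by (simp add: ennreal_mult)
    qed
    have "(\<Union>p\<in>I. E p) \<subseteq> frontier (prism z h)"
    proof
      fix v assume "v \<in> (\<Union>p\<in>I. E p)"
      then obtain p where p: "p \<in> I" "v \<in> E p" by blast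
      have "v \<in> prism z h"
        unfolding mem_prism
      proof
        fix j show "0 \<le> v $ j \<and> v $ j \<le> (if j = z then h else 1)"
        proof (cases "j = fst p \<or> j = z")
          case True
          then show ?thesis
            using E(1-3)[OF p] p(1) by (cases "snd p") (auto simp: I_def)
        next
          case False
          then show ?thesis
            using E(4)[OF p, of j] \<delta> by simp
        qed
      qed
      moreover have "v \<notin> box 0 (\<chi> j. if j = z then h else 1)"
        using E(1)[OF p] p(1) by (auto simp: mem_box_cart I_def intro!: exI[of _ "fst p"])
      ultimately show "v \<in> frontier (prism z h)"
        by (simp add: prism_def frontier_cbox)
    qed
    then have "hausdorff (CARD('n) - 1) (\<Union>p\<in>I. E p) \<le> ennreal F"
      using hausdorff_mono by (metis F(1))
    moreover have "(\<Sum>p\<in>I. hausdorff (CARD('n) - 1) (E p)) \<le> hausdorff (CARD('n) - 1) (\<Union>p\<in>I. E p)"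
    proof (rule hausdorff_UN_disjoint_compact)
      show "finite I" by (simp add: I_def)
      show "compact (E p)" for p unfolding E_def by (intro compact_translation compact_cbox)
    qed fact
    ultimately have "(\<Sum>p\<in>I. ennreal (h * (1 - 2 * \<delta>) ^ (CARD('n) - 2) * \<kappa>)) \<le> ennreal F"
      using HE by simp
    also have "(\<Sum>p\<in>I. ennreal (h * (1 - 2 * \<delta>) ^ (CARD('n) - 2) * \<kappa>))
        = ennreal (\<Sum>p\<in>I. h * (1 - 2 * \<delta>) ^ (CARD('n) - 2) * \<kappa>)"
      using \<kappa> \<delta> \<open>0 < h\<close> by (intro sum_ennreal) simp
    also have "(\<Sum>p\<in>I. h * (1 - 2 * \<delta>) ^ (CARD('n) - 2) * \<kappa>) = ?C * (1 - 2 * \<delta>) ^ (CARD('n) - 2)"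
      by (simp add: I_def card_Compl_singleton)
    finally show ?thesis using F(2) by simp
  qed
  have "((\<lambda>\<delta>. ?C * (1 - 2 * \<delta>) ^ (CARD('n) - 2)) \<longlongrightarrow> ?C * (1 - 2 * 0) ^ (CARD('n) - 2)) (at_right 0)"
    by (intro tendsto_intros)
  moreover have "eventually (\<lambda>\<delta>. ?C * (1 - 2 * \<delta>) ^ (CARD('n) - 2) \<le> F) (at_right 0)"
    using eventually_at_right_less[of "0 :: real"] eventually_at_right_field[of _ "0 :: real"] shrunk
    by (auto intro!: exI[of _ "1 / 2"])
  ultimately have "?C \<le> F"
    using tendsto_upperbound by fastforce
  then show ?thesis
    using \<kappa> \<open>0 < h\<close> unfolding F(1) by (simp add: ennreal_leI flip: ennreal_mult)
qed

section \<open>The chamfered prism and its boundary area\<close>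

definition chamfered_prism :: "'n::finite \<Rightarrow> 'n \<Rightarrow> 'n \<Rightarrow> real \<Rightarrow> real \<Rightarrow> (real ^ 'n) set" where
  "chamfered_prism x y z q h = prism z h \<inter> {v. q * v $ z \<le> v $ x + v $ y}"

text \<open>One inclusion is enough for both purposes: it yields interior points, and it places each
  frontier point on a face of the prism or on the cutting hyperplane.\<close>

lemma interior_chamfered_prism:
  "box 0 (\<chi> j. if j = z then h else 1) \<inter> {v. q * v $ z < v $ x + v $ y} \<subseteq> interior (chamfered_prism x y z q h)"
proof (rule interior_maximal)
  show "open (box 0 (\<chi> j. if j = z then h else 1) \<inter> {v. q * v $ z < v $ x + v $ y})"
    by (intro open_Int open_box open_Collect_less continuous_intros)
  show "box 0 (\<chi> j. if j = z then h else 1) \<inter> {v. q * v $ z < v $ x + v $ y} \<subseteq> chamfered_prism x y z q h"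
    using box_subset_cbox by (force simp: chamfered_prism_def prism_def)
qed

lemma compact_chamfered_prism: "compact (chamfered_prism x y z q h)"
  unfolding chamfered_prism_def prism_def
  by (intro compact_Int_closed compact_cbox closed_Collect_le continuous_intros)

lemma convex_chamfered_prism: "convex (chamfered_prism x y z q h)"
proof -
  have "{v. q * v $ z \<le> v $ x + v $ y} = {v. (axis x 1 + axis y 1 - q *\<^sub>R axis z 1) \<bullet> v \<ge> 0}"
    by (simp add: inner_diff_left inner_add_left inner_axis' algebra_simps)
  then show ?thesis
    unfolding chamfered_prism_def prism_def by (simp add: convex_Int convex_halfspace_ge)
qed

text \<open>The terms are 2 for bottom and top, \<open>h\<close> for each of the
  \<open>2 * (n - 1)\<close> lateral facets, minus \<open>q * h\<^sup>2 / 2\<close> for each of the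
  two that meet in the cut edge, plus the slanted facet. The top is counted in full; the triangle it
  loses is of second order in \<open>q * h\<close>. The hypothesis \<open>q * h \<le> 1\<close>
  makes the removed triangles fit into their facets.\<close>

lemma frontier_chamfered_prism_le:
  fixes x y z i :: "'n::finite"
  assumes xyz: "x \<noteq> y" "y \<noteq> z" "x \<noteq> z" and "0 < q" "0 < h" "q * h \<le> 1"
  shows "hausdorff (CARD('n) - 1) (frontier (chamfered_prism x y z q h))
    \<le> ennreal (2 + 2 * real (CARD('n) - 1) * h - q * h\<^sup>2 + 0.71 * q * (1 + q) * h\<^sup>2) * unit_facet_measure i"
proof -
  define A where "A = chamfered_prism x y z q h"
  define H where "H = (hausdorff (CARD('n) - 1) :: (real ^ 'n) set \<Rightarrow> ennreal)"
  define E where "E p = {v \<in> A. v $ fst p = (if snd p then (if fst p = z then h else 1) else 0)}"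
    for p :: "'n \<times> bool"
  \<comment> \<open>The slanted facet is divided along its axis of symmetry, since its halves unfold
    into right triangles.\<close>
  define S where "S x y = {v :: real ^ 'n. v $ x + v $ y = q * v $ z \<and> 0 \<le> v $ z \<and> v $ z \<le> h
      \<and> 0 \<le> v $ y \<and> v $ y \<le> v $ x \<and> (\<forall>j. j \<notin> {x, y, z} \<longrightarrow> 0 \<le> v $ j \<and> v $ j \<le> 1)}" for x y
  have A: "0 \<le> v $ j" "v $ j \<le> (if j = z then h else 1)" "q * v $ z \<le> v $ x + v $ y" if "v \<in> A" for v j
    using that by (auto simp: A_def chamfered_prism_def mem_prism)
  have "frontier A \<subseteq> (\<Union>p\<in>UNIV. E p) \<union> (S x y \<union> S y x)"
  proof
    fix v assume v: "v \<in> frontier A"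
    have "v \<in> A"
      using v compact_chamfered_prism[of x y z q h] frontier_subset_closed compact_imp_closed
      unfolding A_def by blast
    have "v \<notin> interior A" using v by (simp add: frontier_def)
    then have "v \<notin> box 0 (\<chi> j. if j = z then h else 1) \<or> \<not> q * v $ z < v $ x + v $ y"
      using interior_chamfered_prism[of z h q x y] unfolding A_def by blast
    then show "v \<in> (\<Union>p\<in>UNIV. E p) \<union> (S x y \<union> S y x)"
    proof
      assume "v \<notin> box 0 (\<chi> j. if j = z then h else 1)"
      moreover have "v \<in> prism z h"
        using \<open>v \<in> A\<close> by (simp add: A_def chamfered_prism_def)
      ultimately obtain j where "v $ j = 0 \<or> v $ j = (if j = z then h else 1)"
        using prism_minus_box by blast
      then have "v \<in> E (j, False) \<or> v \<in> E (j, True)"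
        using \<open>v \<in> A\<close> by (auto simp: E_def)
      then show ?thesis by blast
    next
      assume "\<not> q * v $ z < v $ x + v $ y"
      then have eq: "v $ x + v $ y = q * v $ z" using A(3)[OF \<open>v \<in> A\<close>] by simp
      have "0 \<le> v $ j \<and> v $ j \<le> 1" if "j \<notin> {x, y, z}" for j
        using A(1,2)[OF \<open>v \<in> A\<close>, of j] that by simp
      then have "v \<in> S x y \<or> v \<in> S y x"
        using eq A(1,2)[OF \<open>v \<in> A\<close>, of z] A(1)[OF \<open>v \<in> A\<close>, of x] A(1)[OF \<open>v \<in> A\<close>, of y]
        by (simp add: S_def) linarith
      then show ?thesis by blast
    qed
  qed
  then have "H (frontier A) \<le> H ((\<Union>p\<in>UNIV. E p) \<union> (S x y \<union> S y x))"
    unfolding H_def by (rule hausdorff_mono)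
  also have "\<dots> \<le> H (\<Union>p\<in>UNIV. E p) + (H (S x y) + H (S y x))"
    unfolding H_def by (meson hausdorff_Un order_trans add_left_mono)
  also have "\<dots> \<le> (\<Sum>p\<in>UNIV. H (E p)) + (H (S x y) + H (S y x))"
    unfolding H_def by (intro add_right_mono hausdorff_UN) simp
  finally have le1: "H (frontier A) \<le> (\<Sum>p\<in>UNIV. H (E p)) + (H (S x y) + H (S y x))" .
  have HS: "H (S x y) \<le> ennreal (0.355 * q * (1 + q) * h\<^sup>2) * unit_facet_measure i"
    "H (S y x) \<le> ennreal (0.355 * q * (1 + q) * h\<^sup>2) * unit_facet_measure i"
    unfolding H_def S_def using assms by (intro hausdorff_slanted_half_le; auto)+
  define m where "m p = (if fst p = z then 1 else if fst p \<in> {x, y} \<and> \<not> snd p then h - q * h\<^sup>2 / 2 else h)"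
    for p :: "'n \<times> bool"
  have qh: "q * h\<^sup>2 \<le> h"
    using mult_right_mono[OF \<open>q * h \<le> 1\<close>, of h] \<open>0 < h\<close> by (simp add: power2_eq_square mult.assoc)
  have m0: "0 \<le> m p" for p
    using qh \<open>0 < h\<close> by (simp add: m_def)
  have HE: "H (E p) \<le> ennreal (m p) * unit_facet_measure i" for p
  proof (cases "fst p \<in> {x, y} \<and> \<not> snd p")
    case False
    have "H (E p) \<le> H {v \<in> prism z h. v $ fst p = (if snd p then (if fst p = z then h else 1) else 0)}"
      unfolding H_def by (intro hausdorff_mono) (auto simp: E_def A_def chamfered_prism_def)
    also have "\<dots> \<le> ennreal (if fst p = z then 1 else h) * unit_facet_measure i"
      unfolding H_def using \<open>0 < h\<close> by (rule hausdorff_prism_face_le)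
    finally show ?thesis using False by (auto simp: m_def)
  next
    case True
    have *: "H (E p) \<le> ennreal (m p) * unit_facet_measure i"
      if sub: "E p \<subseteq> trapezoid x' y' z q 1 h" and dist: "x' \<noteq> y'" "y' \<noteq> z" "x' \<noteq> z" for x' y'
    proof -
      have "H (E p) \<le> H (trapezoid x' y' z q 1 h)"
        unfolding H_def using sub by (rule hausdorff_mono)
      also have "\<dots> \<le> ennreal ((1 - q * h / 2) * h) * unit_facet_measure i"
        unfolding H_def using dist assms by (intro hausdorff_trapezoid_le) auto
      also have "(1 - q * h / 2) * h = m p"
        using True xyz by (auto simp: m_def power2_eq_square algebra_simps)
      finally show ?thesis .
    qed
    have "0 \<le> v $ j \<and> v $ j \<le> 1" if "v \<in> E p" "j \<noteq> z" for v j
      using A(1,2)[of v j] that by (simp add: E_def)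
    moreover have "0 \<le> v $ z \<and> v $ z \<le> h" "q * v $ z \<le> v $ x + v $ y" if "v \<in> E p" for v
      using A(1,2)[of v z] A(3)[of v] that by (simp_all add: E_def)
    ultimately have "fst p = x \<Longrightarrow> E p \<subseteq> trapezoid x y z q 1 h" "fst p = y \<Longrightarrow> E p \<subseteq> trapezoid y x z q 1 h"
      using True xyz by (fastforce simp: trapezoid_def E_def)+
    then show ?thesis using True * xyz by blast
  qed
  have "(\<Sum>p\<in>UNIV. H (E p)) \<le> (\<Sum>p\<in>UNIV. ennreal (m p) * unit_facet_measure i)"
    by (intro sum_mono HE)
  also have "\<dots> = ennreal (\<Sum>p\<in>UNIV. m p) * unit_facet_measure i"
    using m0 by (simp add: sum_distrib_right[symmetric])
  also have "(\<Sum>p\<in>UNIV. m p) = (\<Sum>j\<in>UNIV. \<Sum>b\<in>UNIV. m (j, b))"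
    by (simp add: sum.cartesian_product)
  also have "\<dots> = (\<Sum>j\<in>UNIV. if j = z then 2 else if j \<in> {x, y} then 2 * h - q * h\<^sup>2 / 2 else 2 * h)"
    by (intro sum.cong) (auto simp: UNIV_bool m_def)
  also have "\<dots> = 2 + 2 * (2 * h - q * h\<^sup>2 / 2) + real (CARD('n) - 3) * (2 * h)"
  proof -
    have "(\<Sum>j\<in>- {x, y, z}. if j = z then 2 else if j \<in> {x, y} then 2 * h - q * h\<^sup>2 / 2 else 2 * h)
        = (\<Sum>j\<in>- {x, y, z}. 2 * h)"
      by (intro sum.cong) auto
    also have "\<dots> = real (CARD('n) - 3) * (2 * h)"
      using xyz by (simp add: Compl_eq_Diff_UNIV card_Diff_subset numeral_3_eq_3)
    finally show ?thesis
      unfolding sum_UNIV_three[OF xyz] using xyz by simp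
  qed
  also have "\<dots> = 2 + 2 * real (CARD('n) - 1) * h - q * h\<^sup>2"
  proof -
    have "3 = card {x, y, z}" using xyz by simp
    also have "\<dots> \<le> CARD('n)" by (intro card_mono) auto
    finally show ?thesis by (simp add: of_nat_diff algebra_simps)
  qed
  finally have le2: "(\<Sum>p\<in>UNIV. H (E p)) \<le> ennreal (2 + 2 * real (CARD('n) - 1) * h - q * h\<^sup>2) * unit_facet_measure i" .
  have nn: "0 \<le> 2 + 2 * real (CARD('n) - 1) * h - q * h\<^sup>2"
  proof -
    have "2 \<le> card {x, y}" using xyz by simp
    also have "\<dots> \<le> CARD('n)" by (intro card_mono) auto
    finally have "1 * h \<le> 2 * real (CARD('n) - 1) * h"
      using \<open>0 < h\<close> by (intro mult_right_mono) auto
    then show ?thesis using qh by simp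
  qed
  have "H (frontier A) \<le> ennreal (2 + 2 * real (CARD('n) - 1) * h - q * h\<^sup>2) * unit_facet_measure i
      + (ennreal (0.355 * q * (1 + q) * h\<^sup>2) * unit_facet_measure i
        + ennreal (0.355 * q * (1 + q) * h\<^sup>2) * unit_facet_measure i)"
    using le1 le2 HS by (meson add_mono order_trans)
  also have "\<dots> = (ennreal (2 + 2 * real (CARD('n) - 1) * h - q * h\<^sup>2)
      + (ennreal (0.355 * q * (1 + q) * h\<^sup>2) + ennreal (0.355 * q * (1 + q) * h\<^sup>2))) * unit_facet_measure i"
    by (simp add: distrib_right)
  also have "ennreal (2 + 2 * real (CARD('n) - 1) * h - q * h\<^sup>2)
      + (ennreal (0.355 * q * (1 + q) * h\<^sup>2) + ennreal (0.355 * q * (1 + q) * h\<^sup>2))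
      = ennreal (2 + 2 * real (CARD('n) - 1) * h - q * h\<^sup>2 + 0.71 * q * (1 + q) * h\<^sup>2)"
    using nn \<open>0 < q\<close> by (simp flip: ennreal_plus)
  finally show ?thesis by (simp add: H_def A_def)
qed

section \<open>Cylinders as prisms, membership in the canal class, and volumes\<close>

lemma prism_nth_bounds:
  assumes "v \<in> prism z h"
  shows "0 \<le> v $ j" "v $ z \<le> h" "j \<noteq> z \<Longrightarrow> v $ j \<le> 1"
  using assms unfolding mem_prism by (auto dest: spec[of _ z] spec[of _ j])

lemma cylinder_axis_prism:
  fixes z :: "'n::finite"
  assumes "0 \<le> h"
  shows "cylinder (axis z 1) (prism z 0) h = prism z h"
proof
  show "cylinder (axis z 1) (prism z 0) h \<subseteq> prism z h"
  proof
    fix v assume "v \<in> cylinder (axis z 1) (prism z 0) h"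
    then obtain w t where w: "v = w + h *\<^sub>R (t *\<^sub>R axis z 1)" "w \<in> prism z 0" "0 \<le> t" "t \<le> 1"
      by (auto simp: cylinder_def set_plus_def closed_segment_def)
    then have "h * t \<le> h" "0 \<le> h * t"
      using assms mult_left_mono[of t 1 h] by simp_all
    then show "v \<in> prism z h"
      using prism_nth_bounds[OF w(2)] by (auto simp: mem_prism w(1) axis_def intro: add_increasing2 dest: antisym)
  qed
  show "prism z h \<subseteq> cylinder (axis z 1) (prism z 0) h"
  proof
    fix v assume v: "v \<in> prism z h"
    define t where "t = (if h = 0 then 0 else v $ z / h)"
    have z: "0 \<le> v $ z" "v $ z \<le> h" using v by (auto simp: mem_prism dest: spec[of _ z])
    then have t: "0 \<le> t" "t \<le> 1" "h * t = v $ z"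
      using assms by (auto simp: t_def)
    have "v = (v - (h * t) *\<^sub>R axis z 1) + h *\<^sub>R (t *\<^sub>R axis z 1)"
      by simp
    moreover have "v - (h * t) *\<^sub>R axis z 1 \<in> prism z 0"
      using prism_nth_bounds[OF v] t by (auto simp: mem_prism axis_def)
    moreover have "t *\<^sub>R axis z 1 \<in> closed_segment 0 (axis z 1 :: real ^ 'n)"
      using t by (auto simp: closed_segment_def)
    ultimately show "v \<in> cylinder (axis z 1) (prism z 0) h"
      unfolding cylinder_def by (metis imageI set_plus_intro)
  qed
qed

text \<open>The base is the section of a full-dimensional box by the hyperplane. Extending that box
  to \<open>- 1\<close> in direction \<open>z\<close> lets the hyperplane pass through its interior,
  and such a section has the dimension of the hyperplane.\<close>

lemma aff_dim_prism_0:
  fixes z :: "'n::finite"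
  shows "aff_dim (prism z 0) = int CARD('n) - 1"
proof -
  define T where "T = cbox (\<chi> j. if j = z then - 1 else 0) (1 :: real ^ 'n)"
  have "(\<chi> j. if j = z then 0 else 1 / 2) \<in> {v. axis z 1 \<bullet> v = 0} \<inter> interior T"
    by (auto simp: T_def interior_cbox mem_box_cart inner_axis')
  then have "aff_dim ({v. axis z 1 \<bullet> v = 0} \<inter> T) = aff_dim {v :: real ^ 'n. axis z 1 \<bullet> v = 0}"
    by (intro aff_dim_convex_Int_nonempty_interior convex_hyperplane) blast
  also have "\<dots> = int CARD('n) - 1"
    using aff_dim_hyperplane[of "axis z (1 :: real)" 0] by (simp add: axis_eq_0_iff)
  also have "{v. axis z 1 \<bullet> v = 0} \<inter> T = prism z 0"
    unfolding set_eq_iff Int_iff mem_prism T_def mem_box_cart mem_Collect_eq inner_axis'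
    by (fastforce intro: antisym split: if_splits)
  finally show ?thesis .
qed

lemma orth_proj_axis_nth:
  fixes v :: "real ^ 'n::finite"
  shows "orth_proj (axis z 1) v $ j = (if j = z then 0 else v $ j)"
  by (simp add: orth_proj_def inner_axis) (simp add: axis_def)

lemma chamfered_prism_in_canal_class:
  fixes x y z :: "'n::finite"
  assumes xyz: "x \<noteq> y" "y \<noteq> z" "x \<noteq> z" and "0 < q" "0 < h" "q * h \<le> 1"
  shows "chamfered_prism x y z q h \<in> canal_class (axis z 1) (prism z 0)"
proof -
  let ?A = "chamfered_prism x y z q h"
  have "(\<chi> j. if j = z then h / 2 else 1 / 2) \<in> box 0 (\<chi> j. if j = z then h else 1) \<inter> {v. q * v $ z < v $ x + v $ y}"
    using assms by (auto simp: mem_box_cart)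
  then have int: "interior ?A \<noteq> {}"
    using interior_chamfered_prism[of z h q x y] by blast
  then have "?A \<noteq> {}" using interior_subset by blast
  then have "convex_body ?A"
    by (simp add: convex_body_def compact_chamfered_prism convex_chamfered_prism)
  moreover have "orth_proj (axis z 1) ` ?A = prism z 0"
  proof
    have "orth_proj (axis z 1) v \<in> prism z 0" if "v \<in> prism z h" for v
      using prism_nth_bounds[OF that] by (simp add: mem_prism orth_proj_axis_nth)
    then show "orth_proj (axis z 1) ` ?A \<subseteq> prism z 0"
      by (auto simp: chamfered_prism_def)
    show "prism z 0 \<subseteq> orth_proj (axis z 1) ` ?A"
    proof
      \<comment> \<open>At height 0 the cutting condition reads
        \<open>0 \<le> v $ x + v $ y\<close>, so the whole base lies in the body, and the projection
        fixes it.\<close>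
      fix v assume v: "v \<in> prism z 0"
      have "v $ z = 0"
        using prism_nth_bounds(1)[OF v, of z] prism_nth_bounds(2)[OF v] by simp
      then have "orth_proj (axis z 1) v = v" "v \<in> ?A"
        using prism_nth_bounds[OF v] \<open>0 < h\<close> by (auto simp: vec_eq_iff orth_proj_axis_nth chamfered_prism_def mem_prism)
      then show "v \<in> orth_proj (axis z 1) ` ?A" by (metis imageI)
    qed
  qed
  ultimately show ?thesis using int by (simp add: canal_class_def)
qed

lemma hausdorff_full_cbox:
  fixes s :: "'n::finite \<Rightarrow> real" and i :: 'n
  assumes "\<And>i. 0 < s i"
  shows "hausdorff CARD('n) (cbox 0 (vec_lambda s)) = ennreal (\<Prod>i\<in>UNIV. s i) * hausdorff CARD('n) (prism i 1)"
proof -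
  have "prism i 1 = cbox 0 (vec_lambda (indicator (UNIV :: 'n set)))"
    by (simp add: prism_def indicator_def)
  then show ?thesis
    using hausdorff_cbox[of UNIV s] assms by simp
qed

lemma hausdorff_prism:
  fixes z i :: "'n::finite"
  assumes "0 < h"
  shows "hausdorff CARD('n) (prism z h) = ennreal h * hausdorff CARD('n) (prism i 1)"
proof -
  have "(\<Prod>j\<in>UNIV. if j = z then h else 1) = h"
    by simp
  then show ?thesis
    using hausdorff_full_cbox[of "\<lambda>j. if j = z then h else 1" i] assms by (simp add: prism_def)
qed

text \<open>Points cut off satisfy \<open>v $ x + v $ y < q * h\<close>, so they lie in a box with
  two sides \<open>q * h\<close>. This is several times the true loss, but of the same quadratic
  order, and it reduces the volume estimate to a box and subadditivity.\<close>

lemma hausdorff_prism_le_chamfered: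
  fixes x y z i :: "'n::finite"
  assumes xyz: "x \<noteq> y" "y \<noteq> z" "x \<noteq> z" and "0 < q" "0 < h"
  shows "hausdorff CARD('n) (prism z h) \<le> hausdorff CARD('n) (chamfered_prism x y z q h)
    + ennreal ((q * h)\<^sup>2 * h) * hausdorff CARD('n) (prism i 1)"
proof -
  define s where "s j = (if j = x then q * h else if j = y then q * h else if j = z then h else 1)" for j
  have "prism z h \<subseteq> chamfered_prism x y z q h \<union> cbox 0 (vec_lambda s)"
  proof
    fix v assume v: "v \<in> prism z h"
    then have v0: "0 \<le> v $ j" "v $ j \<le> (if j = z then h else 1)" for j by (auto simp: mem_prism)
    have "v \<in> cbox 0 (vec_lambda s)" if "v $ x + v $ y < q * v $ z"
    proof -
      have "q * v $ z \<le> q * h" using v0(2)[of z] \<open>0 < q\<close> by simp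
      then have "v $ x \<le> q * h" "v $ y \<le> q * h"
        using that v0(1)[of x] v0(1)[of y] by linarith+
      then show ?thesis
        using v0 by (auto simp: mem_box_cart s_def)
    qed
    then show "v \<in> chamfered_prism x y z q h \<union> cbox 0 (vec_lambda s)"
      using v by (cases "q * v $ z \<le> v $ x + v $ y") (auto simp: chamfered_prism_def)
  qed
  then have "hausdorff CARD('n) (prism z h)
      \<le> hausdorff CARD('n) (chamfered_prism x y z q h) + hausdorff CARD('n) (cbox 0 (vec_lambda s))"
    by (meson hausdorff_mono hausdorff_Un order_trans)
  also have "hausdorff CARD('n) (cbox 0 (vec_lambda s)) = ennreal (\<Prod>j\<in>UNIV. s j) * hausdorff CARD('n) (prism i 1)"
    using assms by (intro hausdorff_full_cbox) (auto simp: s_def)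
  also have "(\<Prod>j\<in>UNIV. s j) = (q * h)\<^sup>2 * h"
  proof -
    have "UNIV = insert x (insert y (insert z (- {x, y, z})))" by auto
    then have "(\<Prod>j\<in>UNIV. s j) = (\<Prod>j\<in>insert x (insert y (insert z (- {x, y, z}))). s j)" by simp
    also have "\<dots> = s x * (s y * (s z * (\<Prod>j\<in>- {x, y, z}. s j)))"
      using xyz by simp
    also have "(\<Prod>j\<in>- {x, y, z}. s j) = 1"
      by (intro prod.neutral) (auto simp: s_def)
    finally show ?thesis using xyz by (simp add: s_def power2_eq_square)
  qed
  finally show ?thesis .
qed

lemma ennreal_divide_mono:
  fixes a b c d :: ennreal
  assumes "a \<le> b" "d \<le> c"
  shows "a / c \<le> b / d"
proof -
  have "inverse c \<le> inverse d"
  proof (cases "d = 0 \<or> c = top")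
    case False
    then obtain r s where "c = ennreal r" "d = ennreal s" "0 < s" "s \<le> r"
      using \<open>d \<le> c\<close> by (cases c; cases d) (auto simp: less_le top_unique)
    then show ?thesis by (simp add: inverse_ennreal le_imp_inverse_le)
  qed auto
  then show ?thesis
    unfolding divide_ennreal_def using assms by (intro mult_mono) auto
qed

section \<open>The comparison\<close>

theorem proposition3p1:
  assumes "CARD('n::finite) \<ge> 3"
  shows "\<exists>(u :: real ^ 'n) C A.
    u \<in> sphere 0 1 \<and>
    convex_body C \<and> aff_dim C = int CARD('n) - 1 \<and> C \<subseteq> orth_hyperplane u \<and>
    A \<in> canal_class u C \<and>
    (\<exists>L. ((\<lambda>h. hausdorff CARD('n) (cylinder u C h)
               / hausdorff (CARD('n) - 1) (frontier (cylinder u C h))) \<longlongrightarrow> L) at_top \<and>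
         hausdorff CARD('n) A / hausdorff (CARD('n) - 1) (frontier A) > L)"
proof -
  obtain B :: "'n set" where "card B = 3"
    using obtain_subset_with_card_n[OF assms] by blast
  then obtain x y z :: 'n where xyz: "x \<noteq> y" "y \<noteq> z" "x \<noteq> z"
    by (auto simp: card_3_iff)
  obtain \<kappa> where \<kappa>: "unit_facet_measure z = ennreal \<kappa>" "0 < \<kappa>"
    using unit_facet_measure_pos[of z] unit_facet_measure_finite[of z]
    by (cases "unit_facet_measure z") auto
  have cube: "prism z 1 = cbox 0 (vec_lambda (indicator (UNIV :: 'n set)))"
    by (simp add: prism_def indicator_def)
  obtain V where V: "hausdorff CARD('n) (prism z 1) = ennreal V" "0 < V"
    using hausdorff_unit_cube_pos[of "UNIV :: 'n set"] hausdorff_cbox_finite[of "UNIV :: 'n set" "indicator UNIV"]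
    unfolding cube[symmetric] by (cases "hausdorff CARD('n) (prism z 1)") auto
  define N where "N = real CARD('n)"
  have N: "3 \<le> N" "real (CARD('n) - 1) = N - 1"
    using assms by (auto simp: N_def of_nat_diff)
  \<comment> \<open>The target is \<open>S < 2 * (N - 1) * (1 - a\<^sup>2) * h\<close> for the area
    factor \<open>S\<close> below, that is, \<open>2 + 0.71 * a\<^sup>2 + 2 * (N - 1) * a\<^sup>2 *
    h < 0.29 * a * h\<close>. With \<open>N * a = 1 / 10\<close> and \<open>a * h = 36\<close> the
    left side is at most 2 + 0.71 + 7.2 = 9.91 and the right side is 10.44.\<close>
  define a h q where "a = 1 / (10 * N)" and "h = 360 * N" and "q = a / h"
  have pos: "0 < a" "0 < h" "0 < q" "q * h = a" "a \<le> 1"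
    using N by (auto simp: a_def h_def q_def)
  define A where "A = chamfered_prism x y z q h"
  \<comment> \<open>The volume is \<open>h * V\<close>, and the boundary area lies between the
    lateral area \<open>2 * (N - 1) * h * \<kappa>\<close> and that plus
    \<open>2 * \<kappa>\<close>; the bounded term disappears in the limit.\<close>
  define L where "L = V / (2 * (N - 1) * \<kappa>)"

  have lim: "((\<lambda>h. hausdorff CARD('n) (cylinder (axis z 1) (prism z 0) h)
      / hausdorff (CARD('n) - 1) (frontier (cylinder (axis z 1) (prism z 0) h))) \<longlongrightarrow> ennreal L) at_top"
  proof (rule tendsto_sandwich)
    have ev: "eventually (\<lambda>h :: real. 0 < h) at_top" by (rule eventually_gt_at_top)
    have cyl: "hausdorff CARD('n) (cylinder (axis z 1) (prism z 0) h) = ennreal (h * V)"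
        "hausdorff (CARD('n) - 1) (frontier (cylinder (axis z 1) (prism z 0) h)) \<le> ennreal ((2 + 2 * (N - 1) * h) * \<kappa>)"
        "ennreal (2 * (N - 1) * h * \<kappa>) \<le> hausdorff (CARD('n) - 1) (frontier (cylinder (axis z 1) (prism z 0) h))"
      if "0 < h" for h
      using that hausdorff_prism[OF that, of z z] frontier_prism_le[OF that, of z z] frontier_prism_ge[OF that, of z z]
        assms N V \<kappa> by (simp_all add: cylinder_axis_prism ennreal_mult)
    show "eventually (\<lambda>h. ennreal (V / ((2 / h + 2 * (N - 1)) * \<kappa>)) \<le> hausdorff CARD('n) (cylinder (axis z 1) (prism z 0) h)
      / hausdorff (CARD('n) - 1) (frontier (cylinder (axis z 1) (prism z 0) h))) at_top"
      using ev
    proof eventually_elim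
      case (elim h)
      have "V / ((2 / h + 2 * (N - 1)) * \<kappa>) = (h * V) / ((2 + 2 * (N - 1) * h) * \<kappa>)"
        using elim N \<kappa> by (simp add: divide_simps)
      also have "ennreal \<dots> = ennreal (h * V) / ennreal ((2 + 2 * (N - 1) * h) * \<kappa>)"
        using elim N \<kappa> V by (intro divide_ennreal[symmetric]) (auto intro!: mult_pos_pos add_pos_pos)
      also have "\<dots> \<le> hausdorff CARD('n) (cylinder (axis z 1) (prism z 0) h)
      / hausdorff (CARD('n) - 1) (frontier (cylinder (axis z 1) (prism z 0) h))"
        using cyl[OF elim] by (intro ennreal_divide_mono) auto
      finally show ?case .
    qed
    show "eventually (\<lambda>h. hausdorff CARD('n) (cylinder (axis z 1) (prism z 0) h)
      / hausdorff (CARD('n) - 1) (frontier (cylinder (axis z 1) (prism z 0) h)) \<le> ennreal L) at_top"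
      using ev
    proof eventually_elim
      case (elim h)
      have "hausdorff CARD('n) (cylinder (axis z 1) (prism z 0) h)
          / hausdorff (CARD('n) - 1) (frontier (cylinder (axis z 1) (prism z 0) h))
          \<le> ennreal (h * V) / ennreal (2 * (N - 1) * h * \<kappa>)"
        using cyl[OF elim] by (intro ennreal_divide_mono) auto
      also have "\<dots> = ennreal ((h * V) / (2 * (N - 1) * h * \<kappa>))"
        using elim N \<kappa> V by (intro divide_ennreal) auto
      also have "(h * V) / (2 * (N - 1) * h * \<kappa>) = L"
        using elim by (simp add: L_def)
      finally show ?case .
    qed
    have "((\<lambda>h. V / ((2 / h + 2 * (N - 1)) * \<kappa>)) \<longlongrightarrow> V / ((0 + 2 * (N - 1)) * \<kappa>)) at_top"
      using N \<kappa>
      by (intro tendsto_intros tendsto_divide_0[OF tendsto_const] filterlim_at_top_imp_at_infinity filterlim_ident) auto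
    then show "((\<lambda>h. ennreal (V / ((2 / h + 2 * (N - 1)) * \<kappa>))) \<longlongrightarrow> ennreal L) at_top"
      by (intro tendsto_ennrealI) (simp add: L_def)
  qed (rule tendsto_const)

  have "ennreal L < hausdorff CARD('n) A / hausdorff (CARD('n) - 1) (frontier A)"
  proof -
    define S where "S = 2 + 2 * (N - 1) * h - a * h + 0.71 * a * (h + a)"
    have vol: "ennreal ((1 - a\<^sup>2) * h * V) \<le> hausdorff CARD('n) A"
    proof -
      \<comment> \<open>The finite volume \<open>a\<^sup>2 * h * V\<close> is added on both sides
        and cancelled, which avoids subtraction in \<open>ennreal\<close>.\<close>
      have "ennreal ((1 - a\<^sup>2) * h * V) + ennreal (a\<^sup>2 * h * V) = ennreal (h * V)"
      proof -
        have "0 \<le> 1 - a\<^sup>2" using pos by (simp add: power_le_one)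
        then show ?thesis using pos V by (simp add: algebra_simps flip: ennreal_plus)
      qed
      also have "\<dots> \<le> hausdorff CARD('n) A + ennreal (a\<^sup>2 * h * V)"
        using hausdorff_prism_le_chamfered[OF xyz pos(3,2), of z] hausdorff_prism[OF pos(2), of z z] V pos
        by (simp add: A_def ennreal_mult)
      finally show ?thesis by simp
    qed
    have surf: "hausdorff (CARD('n) - 1) (frontier A) \<le> ennreal (S * \<kappa>)"
    proof -
      have eq: "2 + 2 * real (CARD('n) - 1) * h - q * h\<^sup>2 + 0.71 * q * (1 + q) * h\<^sup>2 = S"
      proof -
        have "q * h\<^sup>2 = a * h" "q * (1 + q) * h\<^sup>2 = a * (h + a)"
          using pos(4)[symmetric] by (simp_all add: power2_eq_square algebra_simps)
        then show ?thesis unfolding N S_def by (simp add: mult.assoc)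
      qed
      show ?thesis
        using frontier_chamfered_prism_le[OF xyz pos(3,2), of z] pos \<kappa> unfolding eq A_def
        by (simp add: ennreal_mult'')
    qed
    have "a * h = 36" using N by (simp add: a_def h_def)
    have "N * a = 1 / 10" using N by (simp add: a_def)
    have S_lt: "S < 2 * (N - 1) * (1 - a\<^sup>2) * h"
    proof -
      have "a\<^sup>2 \<le> 1" using pos by (simp add: power_le_one)
      have "2 * (N - 1) * a\<^sup>2 * h \<le> 2 * N * a\<^sup>2 * h"
        using pos by (intro mult_right_mono) auto
      also have "\<dots> = 2 * (N * a) * (a * h)"
        by (simp add: power2_eq_square)
      also have "\<dots> = 7.2"
        by (simp add: \<open>a * h = 36\<close> \<open>N * a = 1 / 10\<close>)
      finally have "2 * (N - 1) * a\<^sup>2 * h \<le> 7.2" .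
      moreover have "2 * (N - 1) * (1 - a\<^sup>2) * h = 2 * (N - 1) * h - 2 * (N - 1) * a\<^sup>2 * h"
        by (simp add: algebra_simps)
      moreover have "S = 2 + 2 * (N - 1) * h - 36 + 0.71 * 36 + 0.71 * a\<^sup>2"
        by (simp add: S_def \<open>a * h = 36\<close> distrib_left power2_eq_square mult.assoc)
      moreover have "71 / 100 * a\<^sup>2 \<le> 71 / 100"
        using \<open>a\<^sup>2 \<le> 1\<close> by simp
      ultimately show ?thesis by simp
    qed
    have "0 < S"
    proof -
      have "0 \<le> 0.71 * a * (h + a)" using pos by simp
      moreover have "1 * h \<le> 2 * (N - 1) * h" using N pos by (intro mult_right_mono) auto
      moreover have "36 \<le> h" using N by (simp add: h_def)
      ultimately show ?thesis unfolding S_def \<open>a * h = 36\<close> by linarith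
    qed
    \<comment> \<open>Both quotients carry the factor \<open>V / \<kappa>\<close>, so the unknown
      normalisations cancel and \<open>S_lt\<close> is all that remains.\<close>
    have "L < ((1 - a\<^sup>2) * h * V) / (S * \<kappa>)"
    proof -
      have "V * S < V * (2 * (N - 1) * (1 - a\<^sup>2) * h)"
        using S_lt V by simp
      then show ?thesis
        using N \<kappa> \<open>0 < S\<close> by (simp add: L_def divide_simps) (simp add: algebra_simps)
    qed
    moreover have "0 \<le> L" using N \<kappa> V by (simp add: L_def)
    ultimately have "ennreal L < ennreal (((1 - a\<^sup>2) * h * V) / (S * \<kappa>))"
      by (intro ennreal_lessI) linarith+
    also have "\<dots> = ennreal ((1 - a\<^sup>2) * h * V) / ennreal (S * \<kappa>)"
      using \<open>0 < S\<close> \<kappa> V pos by (intro divide_ennreal[symmetric]) (auto simp: power_le_one)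
    also have "\<dots> \<le> hausdorff CARD('n) A / hausdorff (CARD('n) - 1) (frontier A)"
      using vol surf by (rule ennreal_divide_mono)
    finally show ?thesis .
  qed
  moreover have "convex_body (prism z 0 :: (real ^ 'n) set)"
    unfolding convex_body_def prism_def by (auto simp: interval_ne_empty_cart)
  moreover have "prism z 0 \<subseteq> orth_hyperplane (axis z (1 :: real))"
    by (auto simp: orth_hyperplane_def inner_axis' mem_prism dest!: spec[of _ z])
  moreover have "A \<in> canal_class (axis z 1) (prism z 0)"
    unfolding A_def using xyz pos by (intro chamfered_prism_in_canal_class) auto
  moreover have "axis z 1 \<in> sphere (0 :: real ^ 'n) 1"
    by simp
  ultimately show ?thesis
    using aff_dim_prism_0 lim by blast
qed

end
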